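(* For a given pair $(G,\tau)$, where $G$ is a graph of order $n$ and size $m$ and $\tau$ is a threshold function for $G$, and for a given tree-decomposition of $G$ of width $w$ with $O(n)$ nodes, a dynamic monopoly $D$ of $(G,\tau)$ with $|D|\leq(w+1)\,{\rm dyn}(G,\tau)$ can be determined in time $O(n^2m)$.
   Context: All graphs are finite, simple and undirected. A threshold function for a graph $G$ is a function $\tau:V(G)\to\mathbb{Z}$. For $D\subseteq V(G)$, the hull $H_{(G,\tau)}(D)$ is the smallest set $H\subseteq V(G)$ such that $D\subseteq H$ and $u\in H$ for every vertex $u$ with $|H\cap N_G(u)|\geq\tau(u)$. A set $D$ is a dynamic monopoly of $(G,\tau)$ if $H_{(G,\tau)}(D)=V(G)$; ${\rm dyn}(G,\tau)$ is the minimum order of a dynamic monopoly. A tree-decomposition of $G$ is a pair $(T,(X_t)_{t\in V(T)})$ with $T$ a tree and $X_t\subseteq V(G)$ such that $\bigcup_t X_t=V(G)$, every edge of $G$ lies in some $X_t$, and for every vertex $u$ the nodes $t$ with $u\in X_t$ induce a subtree of $T$; its width is $\max_t|X_t|-1$.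
   Formalization: The time bound is proved as O(n^2 max(1,m)): exactly O(n^2 m) when the graph has at least one edge, and O(n^2) for edgeless graphs, where the literal bound n^2 m would be zero and no algorithm could meet it. *)

theory Defs
  imports Main
begin

section \<open>Graphs, hulls and dynamic monopolies\<close>

text \<open>Undirected graphs are given by a vertex set and a set of two-element edge sets.  (The notion
  of tree for symmetric digraphs in the AFP entry Graph-Theory does not fit: there every edge
  traversed back and forth counts as a cycle.)\<close>

type_synonym 'a graph = "'a set \<times> 'a set set"

abbreviation verts :: "'a graph \<Rightarrow> 'a set" where "verts G \<equiv> fst G"
abbreviation edges :: "'a graph \<Rightarrow> 'a set set" where "edges G \<equiv> snd G"

definition simple_graph :: "'a graph \<Rightarrow> bool" where
  "simple_graph G \<longleftrightarrow> finite (verts G) \<and> (\<forall>e\<in>edges G. e \<subseteq> verts G \<and> card e = 2)"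

definition nbhd :: "'a graph \<Rightarrow> 'a \<Rightarrow> 'a set" where
  "nbhd G u = {v. {u, v} \<in> edges G}"

definition hull_closed :: "'a graph \<Rightarrow> ('a \<Rightarrow> int) \<Rightarrow> 'a set \<Rightarrow> bool" where
  "hull_closed G \<tau> H \<longleftrightarrow> (\<forall>u\<in>verts G. int (card (H \<inter> nbhd G u)) \<ge> \<tau> u \<longrightarrow> u \<in> H)"

definition hull :: "'a graph \<Rightarrow> ('a \<Rightarrow> int) \<Rightarrow> 'a set \<Rightarrow> 'a set" where
  "hull G \<tau> D = \<Inter> {H. H \<subseteq> verts G \<and> D \<subseteq> H \<and> hull_closed G \<tau> H}"

text \<open>The intersection really is the smallest set in question:\<close>

lemma hull_is_smallest:
  assumes "simple_graph G" and "D \<subseteq> verts G"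
  shows "hull G \<tau> D \<subseteq> verts G" and "D \<subseteq> hull G \<tau> D" and "hull_closed G \<tau> (hull G \<tau> D)"
    and "\<And>H. H \<subseteq> verts G \<Longrightarrow> D \<subseteq> H \<Longrightarrow> hull_closed G \<tau> H \<Longrightarrow> hull G \<tau> D \<subseteq> H"
proof -
  have "verts G \<in> {H. H \<subseteq> verts G \<and> D \<subseteq> H \<and> hull_closed G \<tau> H}"
    using assms by (auto simp: hull_closed_def)
  then show "hull G \<tau> D \<subseteq> verts G" unfolding hull_def by blast
  show "D \<subseteq> hull G \<tau> D" unfolding hull_def by blast
  show least: "hull G \<tau> D \<subseteq> H" if "H \<subseteq> verts G" "D \<subseteq> H" "hull_closed G \<tau> H" for H
    using that unfolding hull_def by blast
  show "hull_closed G \<tau> (hull G \<tau> D)"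
    unfolding hull_closed_def
  proof (intro ballI impI)
    fix u assume u: "u \<in> verts G" "\<tau> u \<le> int (card (hull G \<tau> D \<inter> nbhd G u))"
    have "u \<in> H" if H: "H \<subseteq> verts G" "D \<subseteq> H" "hull_closed G \<tau> H" for H
    proof -
      have "finite H" using H(1) assms(1) finite_subset unfolding simple_graph_def by blast
      then have "card (hull G \<tau> D \<inter> nbhd G u) \<le> card (H \<inter> nbhd G u)"
        by (intro card_mono) (use least[OF H] in auto)
      then show "u \<in> H" using u H(3) unfolding hull_closed_def by force
    qed
    then show "u \<in> hull G \<tau> D" unfolding hull_def by blast
  qed
qed

definition dynamic_monopoly :: "'a graph \<Rightarrow> ('a \<Rightarrow> int) \<Rightarrow> 'a set \<Rightarrow> bool" where
  "dynamic_monopoly G \<tau> D \<longleftrightarrow> D \<subseteq> verts G \<and> hull G \<tau> D = verts G"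

definition dyn :: "'a graph \<Rightarrow> ('a \<Rightarrow> int) \<Rightarrow> nat" where
  "dyn G \<tau> = Min (card ` {D. dynamic_monopoly G \<tau> D})"


section \<open>Tree-decompositions\<close>

definition connected_graph :: "'a graph \<Rightarrow> bool" where
  "connected_graph G \<longleftrightarrow> verts G \<noteq> {} \<and>
     (\<forall>u\<in>verts G. \<forall>v\<in>verts G. (u, v) \<in> {(x, y). {x, y} \<in> edges G}\<^sup>*)"

definition cycle_in :: "'a graph \<Rightarrow> 'a list \<Rightarrow> bool" where
  "cycle_in G c \<longleftrightarrow> length c \<ge> 3 \<and> distinct c \<and>
     (\<forall>i<length c. {c ! i, c ! (Suc i mod length c)} \<in> edges G)"

definition tree :: "'a graph \<Rightarrow> bool" where
  "tree T \<longleftrightarrow> simple_graph T \<and> connected_graph T \<and> (\<nexists>c. cycle_in T c)"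

definition induced :: "'a graph \<Rightarrow> 'a set \<Rightarrow> 'a graph" where
  "induced G S = (verts G \<inter> S, {e \<in> edges G. e \<subseteq> S})"

definition tree_decomposition :: "'a graph \<Rightarrow> 'b graph \<Rightarrow> ('b \<Rightarrow> 'a set) \<Rightarrow> bool" where
  "tree_decomposition G T X \<longleftrightarrow> tree T \<and>
     (\<Union>t\<in>verts T. X t) = verts G \<and>
     (\<forall>e\<in>edges G. \<exists>t\<in>verts T. e \<subseteq> X t) \<and>
     (\<forall>u\<in>verts G. tree (induced T {t \<in> verts T. u \<in> X t}))"

definition width :: "'b graph \<Rightarrow> ('b \<Rightarrow> 'a set) \<Rightarrow> int" where
  "width T X = int (Max ((\<lambda>t. card (X t)) ` verts T)) - 1"


section \<open>Programs and running time\<close>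

text \<open>A deeply embedded deterministic language for uniform-cost random access machines.  The memory
  consists of named integer arrays indexed by integers; since a program mentions only finitely many
  names, this is a single random access memory up to interleaving.  A scalar variable \<open>x\<close> is
  \<open>x[0]\<close>.  The only arithmetic is addition and subtraction: under the uniform cost measure,
  multiplication would make the model unreasonably strong.  Every evaluation of an
  operator, constant, array access or test costs one unit.\<close>

datatype aexp =
    Const int
  | Arr string aexp
  | Plus aexp aexp
  | Minus aexp aexp

datatype bexp =
    Less aexp aexp
  | Neg bexp
  | And bexp bexp

datatype com =
    Skip
  | Assign string aexp aexp  (\<open>_[_] ::= _\<close> [1000, 0, 61] 61)
  | Seq com com  (\<open>_;;/ _\<close> [60, 61] 60)
  | If bexp com com
  | While bexp com

type_synonym store = "string \<Rightarrow> int \<Rightarrow> int"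

fun aval :: "aexp \<Rightarrow> store \<Rightarrow> int" where
  "aval (Const k) s = k"
| "aval (Arr a e) s = s a (aval e s)"
| "aval (Plus e f) s = aval e s + aval f s"
| "aval (Minus e f) s = aval e s - aval f s"

fun bval :: "bexp \<Rightarrow> store \<Rightarrow> bool" where
  "bval (Less e f) s \<longleftrightarrow> aval e s < aval f s"
| "bval (Neg b) s \<longleftrightarrow> \<not> bval b s"
| "bval (And b c) s \<longleftrightarrow> bval b s \<and> bval c s"

fun acost :: "aexp \<Rightarrow> nat" where
  "acost (Const k) = 1"
| "acost (Arr a e) = 1 + acost e"
| "acost (Plus e f) = 1 + acost e + acost f"
| "acost (Minus e f) = 1 + acost e + acost f"

fun bcost :: "bexp \<Rightarrow> nat" where
  "bcost (Less e f) = 1 + acost e + acost f"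
| "bcost (Neg b) = 1 + bcost b"
| "bcost (And b c) = 1 + bcost b + bcost c"

text \<open>\<open>exec c s t s'\<close>: started in store \<open>s\<close>, the program \<open>c\<close> terminates after
  exactly \<open>t\<close> time units in store \<open>s'\<close>.\<close>

inductive exec :: "com \<Rightarrow> store \<Rightarrow> nat \<Rightarrow> store \<Rightarrow> bool" where
  exec_Skip: "exec Skip s 1 s"
| exec_Assign: "exec (a[e] ::= f) s (1 + acost e + acost f) (s(a := (s a)(aval e s := aval f s)))"
| exec_Seq: "exec c s t s' \<Longrightarrow> exec d s' t' s'' \<Longrightarrow> exec (c ;; d) s (t + t') s''"
| exec_IfTrue: "bval b s \<Longrightarrow> exec c s t s' \<Longrightarrow> exec (If b c d) s (1 + bcost b + t) s'"
| exec_IfFalse: "\<not> bval b s \<Longrightarrow> exec d s t s' \<Longrightarrow> exec (If b c d) s (1 + bcost b + t) s'"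
| exec_WhileFalse: "\<not> bval b s \<Longrightarrow> exec (While b c) s (1 + bcost b) s"
| exec_WhileTrue: "bval b s \<Longrightarrow> exec c s t s' \<Longrightarrow> exec (While b c) s' t' s'' \<Longrightarrow>
    exec (While b c) s (1 + bcost b + t + t') s''"

inductive_cases SkipE: "exec Skip s t s'"
inductive_cases AssignE: "exec (a[e] ::= f) s t s'"
inductive_cases SeqE: "exec (c ;; d) s t s'"
inductive_cases IfE: "exec (If b c d) s t s'"
inductive_cases WhileE: "exec (While b c) s t s'"

lemma exec_deterministic:
  "exec c s t s' \<Longrightarrow> exec c s u s'' \<Longrightarrow> t = u \<and> s' = s''"
proof (induction arbitrary: u s'' rule: exec.induct)
  case (exec_Skip s)
  then show ?case by (auto elim: SkipE)
next
  case (exec_Assign a e f s)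
  then show ?case by (auto elim: AssignE)
next
  case (exec_Seq c s t s' d t' s2)
  from exec_Seq.prems show ?case by (rule SeqE) (auto dest: exec_Seq.IH)
next
  case (exec_IfTrue b s c t s' d)
  from exec_IfTrue.prems show ?case by (rule IfE) (auto simp: exec_IfTrue.hyps dest: exec_IfTrue.IH)
next
  case (exec_IfFalse b s d t s' c)
  from exec_IfFalse.prems show ?case by (rule IfE) (auto simp: exec_IfFalse.hyps dest: exec_IfFalse.IH)
next
  case (exec_WhileFalse b s c)
  from exec_WhileFalse.prems show ?case by (rule WhileE) (simp_all add: exec_WhileFalse.hyps)
next
  case (exec_WhileTrue b s c t s' t' s2)
  from exec_WhileTrue.prems show ?case
    by (rule WhileE) (auto simp: exec_WhileTrue.hyps dest: exec_WhileTrue.IH)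
qed


section \<open>Input and output conventions\<close>

text \<open>Vertices and nodes are numbered from 0.  A graph is presented to a program by its order and an
  arbitrary list of its edges, each listed once in arbitrary orientation; the bags are presented by
  duplicate-free lists in arbitrary order.\<close>

definition graph_code :: "nat graph \<Rightarrow> (nat \<times> nat) list \<Rightarrow> bool" where
  "graph_code G es \<longleftrightarrow> verts G = {..<card (verts G)} \<and>
     distinct (map (\<lambda>(u, v). {u, v}) es) \<and> edges G = set (map (\<lambda>(u, v). {u, v}) es)"

definition bags_code :: "nat graph \<Rightarrow> (nat \<Rightarrow> nat set) \<Rightarrow> nat list list \<Rightarrow> bool" where
  "bags_code T X Xs \<longleftrightarrow> length Xs = card (verts T) \<and>
     (\<forall>t<length Xs. distinct (Xs ! t) \<and> set (Xs ! t) = X t)"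

definition array :: "int list \<Rightarrow> int \<Rightarrow> int" where
  "array xs i = (if 0 \<le> i \<and> i < int (length xs) then xs ! nat i else 0)"

text \<open>The bags are concatenated in the array \<open>bag\<close>; bag \<open>t\<close> occupies the positions from
  \<open>start[t]\<close> up to, but excluding, \<open>start[t + 1]\<close>.  All memory not holding
  input is zero.\<close>

definition input_store ::
  "nat graph \<Rightarrow> (nat \<times> nat) list \<Rightarrow> (nat \<Rightarrow> int) \<Rightarrow> nat graph \<Rightarrow> (nat \<times> nat) list \<Rightarrow>
   nat list list \<Rightarrow> store" where
  "input_store G es \<tau> T fs Xs = (\<lambda>_ _. 0)(
     ''n'' := array [int (card (verts G))],
     ''m'' := array [int (length es)],
     ''eu'' := array (map (\<lambda>(u, v). int u) es),
     ''ev'' := array (map (\<lambda>(u, v). int v) es),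
     ''tau'' := array (map \<tau> [0..<card (verts G)]),
     ''nodes'' := array [int (card (verts T))],
     ''links'' := array [int (length fs)],
     ''tu'' := array (map (\<lambda>(t, t'). int t) fs),
     ''tv'' := array (map (\<lambda>(t, t'). int t') fs),
     ''start'' := array (map (\<lambda>t. int (length (concat (take t Xs)))) [0..<Suc (length Xs)]),
     ''bag'' := array (map int (concat Xs)))"

text \<open>A program returns a vertex set in the form of an indicator array \<open>out\<close>.\<close>

definition output_set :: "nat graph \<Rightarrow> store \<Rightarrow> nat set" where
  "output_set G s = {v \<in> verts G. s ''out'' (int v) \<noteq> 0}"

end

theory Submission
  imports Defs
begin

text \<open>Prune the tree of the decomposition leaf by leaf.  When a leaf \<open>t\<close> with remaining neighbour
  \<open>p\<close> is pruned, add \<open>X t\<close> to \<open>D\<close> unless \<open>X t\<close> is already contained in the hull of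
  \<open>D \<union> X p\<close>.  This keeps every vertex of the pruned part around \<open>p\<close> inside the hull of \<open>D \<union> X p\<close>,
  so that in the end the hull of \<open>D\<close> is everything.  If \<open>X t\<close> is added, then every dynamic
  monopoly contains a vertex of the part hanging on \<open>t\<close> outside the hull of \<open>D \<union> X p\<close>, because
  \<open>X p\<close> separates that part from the rest of the graph; adding \<open>X t\<close> moves this vertex into the
  hull of \<open>D\<close>, so different bags are charged to different vertices of the monopoly.

  A hull is computed with a queue of activated vertices, scanning all edges once for every vertex
  taken from the queue.  This costs \<open>O(n * max 1 m)\<close> for each of the \<open>O(n)\<close> nodes.\<close>

section \<open>Greedy pruning of a tree-decomposition\<close>

text \<open>The test with \<open>X p\<close> as free help is what makes the greedy choice safe: a
  part that \<open>D\<close> and the parent bag activate may wait for a later bag, while a part that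
  they do not activate must contain a vertex of every dynamic monopoly. The charging is not recorded
  as an injection from bags to vertices. The invariant keeps only the inequality
  \<open>k \<le> card (M \<inter> H D)\<close> for all dynamic monopolies \<open>M\<close> at once.
  A charged vertex lies in the new hull of \<open>D\<close> and not in the old one, so the
  right-hand side grows strictly whenever a bag is added, and an optimal \<open>M\<close> is
  inserted only at the very end. The obstacle is to state separation after part of the tree is gone.
  The map \<open>own\<close> does it: it is constant along every tree edge with a pruned end, so a
  walk in the tree can leave the part behind \<open>t\<close> only along an edge from
  \<open>t\<close> to a remaining neighbour. The remaining nodes are treated as a forest: acyclicity
  supplies a node with at most one remaining neighbour, and for a node with none the empty set
  replaces \<open>X p\<close>.\<close>

lemma hull_extensive: "D \<subseteq> hull G \<tau> D"
  unfolding hull_def by blast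

lemma hull_mono: "D \<subseteq> D' \<Longrightarrow> hull G \<tau> D \<subseteq> hull G \<tau> D'"
  unfolding hull_def by blast

lemma hull_subset_hull:
  assumes "simple_graph G" "E \<subseteq> verts G" "D \<subseteq> hull G \<tau> E"
  shows "hull G \<tau> D \<subseteq> hull G \<tau> E"
  using hull_is_smallest[OF assms(1), of D] hull_is_smallest[OF assms(1,2)] assms(3)
  by (meson order_trans)

lemma dynamic_monopoly_verts: "simple_graph G \<Longrightarrow> dynamic_monopoly G \<tau> (verts G)"
  unfolding dynamic_monopoly_def
  by (metis hull_is_smallest(1,2) order_refl subset_antisym)

lemma dyn_attained:
  assumes "simple_graph G"
  obtains D where "dynamic_monopoly G \<tau> D" "card D = dyn G \<tau>"
proof -
  have "{D. dynamic_monopoly G \<tau> D} \<subseteq> Pow (verts G)"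
    by (auto simp: dynamic_monopoly_def)
  then have "finite {D. dynamic_monopoly G \<tau> D}"
    using assms by (meson finite_Pow_iff finite_subset simple_graph_def)
  then have "dyn G \<tau> \<in> card ` {D. dynamic_monopoly G \<tau> D}"
    unfolding dyn_def using dynamic_monopoly_verts[OF assms] by (intro Min_in) auto
  then show ?thesis using that by auto
qed

lemma simple_graph_finite_edges: "simple_graph G \<Longrightarrow> finite (edges G)"
  unfolding simple_graph_def by (meson Pow_iff finite_Pow_iff finite_subset subsetI)

lemma simple_graph_edgeE:
  assumes "simple_graph G" "e \<in> edges G" "x \<in> e"
  obtains y where "e = {x, y}" "x \<noteq> y"
  using assms unfolding simple_graph_def by (metis card_2_iff doubleton_eq_iff insertE singletonD)

section \<open>Leaves and edge counts in forests\<close>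

text \<open>Longest-path argument: if every node of \<open>A\<close> had two edges inside
  \<open>A\<close>, the first node of a longest path in \<open>A\<close> would have a second edge.
  Its other end must lie on the path, which closes a cycle.\<close>

lemma forest_exists_leaf:
  assumes T: "simple_graph T" and acyclic: "\<nexists>c. cycle_in T c"
    and A: "A \<subseteq> verts T" "A \<noteq> {}"
  shows "\<exists>t\<in>A. card {e \<in> edges T. t \<in> e \<and> e \<subseteq> A} < 2"
proof (rule ccontr)
  assume "\<not> ?thesis"
  then have two: "card {e \<in> edges T. t \<in> e \<and> e \<subseteq> A} \<ge> 2" if "t \<in> A" for t
    using that by force
  define path where "path p \<longleftrightarrow> p \<noteq> [] \<and> distinct p \<and> set p \<subseteq> A \<and>
    (\<forall>i. Suc i < length p \<longrightarrow> {p ! i, p ! Suc i} \<in> edges T)" for p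
  have finA: "finite A" using T A(1) finite_subset unfolding simple_graph_def by blast
  have bounded: "length p < Suc (card A)" if "path p" for p
    using that finA by (metis card_mono distinct_card le_imp_less_Suc path_def)
  obtain a where "a \<in> A" using A(2) by blast
  then have "path [a]" by (simp add: path_def)
  then obtain p where p: "path p" and longest: "\<And>q. path q \<Longrightarrow> length q \<le> length p"
    using ex_has_greatest_nat[of path "[a]" length "Suc (card A)"] bounded by blast
  obtain x ps where xps: "p = x # ps" using p by (cases p) (auto simp: path_def)
  have "x \<in> A" using p by (auto simp: path_def xps)
  \<comment> \<open>For a one-node path \<open>p ! 1\<close> is unspecified. This does no harm,
    since one set is excluded from at least two edges, whatever it is.\<close>
  have "\<exists>e\<in>{e \<in> edges T. x \<in> e \<and> e \<subseteq> A}. e \<noteq> {p ! 0, p ! 1}"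
  proof (rule ccontr)
    assume "\<not> ?thesis"
    then have "{e \<in> edges T. x \<in> e \<and> e \<subseteq> A} \<subseteq> {{p ! 0, p ! 1}}" by blast
    then have "card {e \<in> edges T. x \<in> e \<and> e \<subseteq> A} \<le> 1"
      by (metis card_mono finite.emptyI finite.insertI is_singletonI is_singleton_altdef)
    with two[OF \<open>x \<in> A\<close>] show False by simp
  qed
  then obtain e where e: "e \<in> edges T" "x \<in> e" "e \<subseteq> A" "e \<noteq> {p ! 0, p ! 1}" by blast
  obtain y where y: "e = {x, y}" "x \<noteq> y" using simple_graph_edgeE[OF T e(1,2)] .
  have "y \<in> set p"
  proof (rule ccontr)
    assume "y \<notin> set p"
    have "{(y # p) ! i, (y # p) ! Suc i} \<in> edges T" if "Suc i < length (y # p)" for i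
      using that p e(1) y by (cases i) (auto simp: path_def xps insert_commute)
    then have "path (y # p)" using p \<open>y \<notin> set p\<close> e(3) y unfolding path_def by simp
    then show False using longest by fastforce
  qed
  \<comment> \<open>The chord from \<open>p ! 0\<close> to \<open>p ! j\<close> closes the initial
    segment of length \<open>Suc j\<close>; \<open>j \<ge> 2\<close> holds because the chord is
    neither a loop nor the first edge of the path.\<close>
  then obtain j where j: "j < length p" "p ! j = y" by (meson in_set_conv_nth)
  have j2: "2 \<le> j"
  proof (rule ccontr)
    assume "\<not> 2 \<le> j"
    then have "j = 0 \<or> j = 1" by linarith
    then show False using j y e(4) by (auto simp: xps)
  qed
  have "cycle_in T (take (Suc j) p)"
    unfolding cycle_in_def
  proof (intro conjI allI impI)
    show "3 \<le> length (take (Suc j) p)" using j j2 by simp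
    show "distinct (take (Suc j) p)" using p by (simp add: path_def)
    fix i assume "i < length (take (Suc j) p)"
    then have i: "i \<le> j" using j by simp
    have len: "length (take (Suc j) p) = Suc j" using j by simp
    show "{take (Suc j) p ! i, take (Suc j) p ! (Suc i mod length (take (Suc j) p))} \<in> edges T"
    proof (cases "i = j")
      case True
      then show ?thesis using j y e(1) unfolding len by (simp add: xps insert_commute del: take_Suc_Cons)
    next
      case False
      then show ?thesis using i j p unfolding len by (simp add: path_def)
    qed
  qed
  with acyclic show False by blast
qed

text \<open>Removing a node of degree at most one loses at most one edge. The bound makes a pass
  over all links of the tree as cheap as a pass over its nodes.\<close>

lemma forest_card_edges:
  assumes T: "simple_graph T" and acyclic: "\<nexists>c. cycle_in T c"
  shows "card (edges T) \<le> card (verts T)"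
proof -
  have "card {e \<in> edges T. e \<subseteq> A} \<le> card A" if "A \<subseteq> verts T" for A
    using that
  proof (induction "card A" arbitrary: A rule: less_induct)
    case less
    have finA: "finite A" using T less.prems finite_subset unfolding simple_graph_def by blast
    show ?case
    proof (cases "A = {}")
      case True
      then have "{e \<in> edges T. e \<subseteq> A} = {}" using T by (auto simp: simple_graph_def)
      then show ?thesis by (metis card.empty zero_le)
    next
      case False
      then obtain t where t: "t \<in> A" "card {e \<in> edges T. t \<in> e \<and> e \<subseteq> A} < 2"
        using forest_exists_leaf[OF T acyclic less.prems] by blast
      have "{e \<in> edges T. e \<subseteq> A} = {e \<in> edges T. e \<subseteq> A - {t}} \<union> {e \<in> edges T. t \<in> e \<and> e \<subseteq> A}"
        by auto
      then have "card {e \<in> edges T. e \<subseteq> A} \<le>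
          card {e \<in> edges T. e \<subseteq> A - {t}} + card {e \<in> edges T. t \<in> e \<and> e \<subseteq> A}"
        by (simp add: card_Un_le)
      also have "card {e \<in> edges T. e \<subseteq> A - {t}} \<le> card (A - {t})"
        using less.prems card_Diff1_less[OF finA t(1)] by (intro less.hyps) auto
      finally show ?thesis using t finA card_Suc_Diff1[OF finA t(1)] by linarith
    qed
  qed
  moreover have "{e \<in> edges T. e \<subseteq> verts T} = edges T" using T by (auto simp: simple_graph_def)
  ultimately show ?thesis by (metis order_refl)
qed

section \<open>The pruning invariant and the charging argument\<close>

locale decomposed_graph =
  fixes G :: "'a graph" and \<tau> :: "'a \<Rightarrow> int" and T :: "'b graph" and X :: "'b \<Rightarrow> 'a set"
  assumes G: "simple_graph G" and TD: "tree_decomposition G T X"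
begin

abbreviation H where "H \<equiv> hull G \<tau>"

lemma
  shows T: "simple_graph T" and acyclic: "\<nexists>c. cycle_in T c"
    and bags: "(\<Union>t\<in>verts T. X t) = verts G"
    and edge_in_bag: "\<And>e. e \<in> edges G \<Longrightarrow> \<exists>t\<in>verts T. e \<subseteq> X t"
  using TD unfolding tree_decomposition_def tree_def by auto

lemma bag_subset: "t \<in> verts T \<Longrightarrow> X t \<subseteq> verts G"
  using bags by blast

lemma finite_verts: "finite (verts G)" "finite (verts T)"
  using G T by (auto simp: simple_graph_def)

lemma bag_card: "t \<in> verts T \<Longrightarrow> int (card (X t)) \<le> width T X + 1"
  unfolding width_def using finite_verts by simp

text \<open>The subtree condition in the form of a walk that stays inside the bags containing
  \<open>u\<close>; induction along this walk yields the separation property.\<close>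

lemma occurrences_connected:
  assumes "u \<in> X s" "u \<in> X s'" "s \<in> verts T" "s' \<in> verts T"
  shows "(s, s') \<in> {(x, y). {x, y} \<in> edges T \<and> u \<in> X x \<and> u \<in> X y}\<^sup>*"
proof -
  have "u \<in> verts G" using assms bags by blast
  then have "connected_graph (induced T {t \<in> verts T. u \<in> X t})"
    using TD unfolding tree_decomposition_def tree_def by blast
  then have "(s, s') \<in> {(x, y). {x, y} \<in> edges (induced T {t \<in> verts T. u \<in> X t})}\<^sup>*"
    using assms unfolding connected_graph_def by (simp add: induced_def)
  then show ?thesis
    by (rule rtrancl_mono[THEN subsetD, rotated]) (auto simp: induced_def)
qed

text \<open>Here \<open>A\<close> is the set of nodes that have not been pruned yet, and \<open>own s\<close> is
  the remaining node that the pruned part around \<open>s\<close> hangs on, or \<open>None\<close> if a whole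
  component has been pruned.\<close>

definition attached :: "'b set \<Rightarrow> ('b \<Rightarrow> 'b option) \<Rightarrow> 'a set \<Rightarrow> bool" where
  "attached A own D \<longleftrightarrow> A \<subseteq> verts T \<and> D \<subseteq> verts G \<and>
     (\<forall>a\<in>A. own a = Some a) \<and> (\<forall>s a. own s = Some a \<longrightarrow> a \<in> A) \<and>
     (\<forall>s s'. {s, s'} \<in> edges T \<and> s \<notin> A \<longrightarrow> own s' = own s) \<and>
     (\<forall>s\<in>verts T. X s \<subseteq> H (D \<union> case_option {} X (own s)))"

text \<open>The number \<open>k\<close> counts the bags that have been added to \<open>D\<close>.\<close>

definition pruned :: "'b set \<Rightarrow> 'a set \<Rightarrow> bool" where
  "pruned A D \<longleftrightarrow> (\<exists>own. attached A own D) \<and>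
     (\<exists>k. int (card D) \<le> (width T X + 1) * int k \<and>
        (\<forall>M. dynamic_monopoly G \<tau> M \<longrightarrow> k \<le> card (M \<inter> H D)))"

lemma pruned_init: "pruned (verts T) {}"
proof -
  have "s \<in> verts T" if "{s, s'} \<in> edges T" for s s'
    using T that by (auto simp: simple_graph_def)
  then have "attached (verts T) (\<lambda>s. if s \<in> verts T then Some s else None) {}"
    by (auto simp: attached_def hull_extensive split: if_splits)
  then show ?thesis unfolding pruned_def by (auto intro!: exI[of _ 0])
qed

lemma pruned_final:
  assumes "pruned {} D"
  shows "dynamic_monopoly G \<tau> D" "int (card D) \<le> (width T X + 1) * int (dyn G \<tau>)"
proof -
  from assms obtain own k where own: "attached {} own D"
    and k: "int (card D) \<le> (width T X + 1) * int k"
      "\<And>M. dynamic_monopoly G \<tau> M \<Longrightarrow> k \<le> card (M \<inter> H D)"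
    unfolding pruned_def by blast
  \<comment> \<open>Values of \<open>own\<close> are remaining nodes, and none remain, so every bag
    lies in the hull of \<open>D\<close> alone.\<close>
  have "own s = None" for s using own unfolding attached_def by (cases "own s") auto
  then have "X s \<subseteq> H D" if "s \<in> verts T" for s
    using own that unfolding attached_def by (metis option.simps(4) sup_bot_right)
  then have "verts G \<subseteq> H D" using bags by blast
  moreover have D: "D \<subseteq> verts G" using own by (simp add: attached_def)
  ultimately show "dynamic_monopoly G \<tau> D"
    using hull_is_smallest(1)[OF G D] by (auto simp: dynamic_monopoly_def)
  obtain M where M: "dynamic_monopoly G \<tau> M" "card M = dyn G \<tau>" using dyn_attained[OF G] .
  have "finite M" using M(1) finite_verts(1) finite_subset unfolding dynamic_monopoly_def by blast
  then have "k \<le> dyn G \<tau>" using k(2)[OF M(1)] M(2) by (metis Int_lower1 card_mono order_trans)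
  moreover have "0 \<le> width T X + 1" by (simp add: width_def)
  ultimately show "int (card D) \<le> (width T X + 1) * int (dyn G \<tau>)"
    using k(1) by (smt (verit) mult_left_mono of_nat_mono)
qed

text \<open>The vertices in the part hanging on \<open>t\<close> that are not activated by \<open>D\<close> and the parent
  bag cannot be activated from outside that part.\<close>

lemma monopoly_hits_pruned_part:
  assumes att: "attached A own D" and t: "t \<in> A"
    and p: "\<And>q. q \<in> A \<Longrightarrow> {t, q} \<in> edges T \<Longrightarrow> p = Some q"
    and p': "\<And>q. p = Some q \<Longrightarrow> q \<in> A"
    and notin: "\<not> X t \<subseteq> H (D \<union> case_option {} X p)" and M: "dynamic_monopoly G \<tau> M"
  shows "\<exists>u\<in>M. (\<exists>s\<in>verts T. own s = Some t \<and> u \<in> X s) \<and> u \<notin> H (D \<union> case_option {} X p)"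
proof (rule ccontr)
  define Y where "Y = D \<union> case_option {} X p"
  define V where "V = (\<Union>s\<in>{s \<in> verts T. own s = Some t}. X s)"
  assume "\<not> ?thesis"
  then have sub: "M \<inter> V \<subseteq> H Y" unfolding V_def Y_def by auto
  have A: "A \<subseteq> verts T" and D: "D \<subseteq> verts G" using att by (auto simp: attached_def)
  have own: "\<And>a. a \<in> A \<Longrightarrow> own a = Some a"
    "\<And>s s'. {s, s'} \<in> edges T \<Longrightarrow> s \<notin> A \<Longrightarrow> own s' = own s"
    using att unfolding attached_def by blast+
  have Y: "Y \<subseteq> verts G"
    using D p' A bag_subset unfolding Y_def by (cases p) auto
  have V: "V \<subseteq> verts G" using bag_subset unfolding V_def by auto
  have HY: "H Y \<subseteq> verts G" "Y \<subseteq> H Y" "hull_closed G \<tau> (H Y)"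
    using hull_is_smallest[OF G Y] by auto
  \<comment> \<open>A vertex outside \<open>Y\<close> that occurs behind \<open>t\<close> occurs
    only behind \<open>t\<close>. Along the walk through its bags, an edge with a pruned end
    preserves \<open>own\<close>; an edge between two remaining nodes would go from \<open>t\<close>
    to its parent and put the vertex into \<open>X p\<close>, hence into \<open>Y\<close>.\<close>
  have only: "own s' = Some t"
    if u: "u \<notin> Y" and s: "s \<in> verts T" "own s = Some t" "u \<in> X s" and s': "s' \<in> verts T" "u \<in> X s'"
    for u s s'
    using occurrences_connected[OF s(3) s'(2) s(1) s'(1)]
  proof (induction rule: rtrancl_induct)
    case base
    show ?case by (rule s(2))
  next
    case (step a b)
    then have ab: "{a, b} \<in> edges T" "{b, a} \<in> edges T" "u \<in> X b" by (auto simp: insert_commute)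
    show ?case
    proof (cases "a \<in> A \<and> b \<in> A")
      case True
      then have "a = t" using step.IH own(1) by force
      then have "p = Some b" using p ab True by blast
      then show ?thesis using ab(3) u by (simp add: Y_def)
    next
      case False
      then show ?thesis using ab(1,2) step.IH own(2) by metis
    qed
  qed
  have nb: "nbhd G u \<subseteq> V" if u: "u \<in> V" "u \<notin> Y" for u
  proof
    fix v assume "v \<in> nbhd G u"
    then obtain s' where "s' \<in> verts T" "{u, v} \<subseteq> X s'"
      using edge_in_bag unfolding nbhd_def by blast
    moreover obtain s where "s \<in> verts T" "own s = Some t" "u \<in> X s" using u(1) by (auto simp: V_def)
    ultimately show "v \<in> V" using only[OF u(2)] unfolding V_def by blast
  qed
  \<comment> \<open>Even if everything outside the part \<open>V\<close> is active, activation stops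
    at \<open>H Y\<close>: a vertex of \<open>V\<close> outside \<open>Y\<close> has all its
    neighbours in \<open>V\<close>, so it sees only active vertices of \<open>H Y\<close>, which is
    closed. A monopoly meeting \<open>V\<close> only inside \<open>H Y\<close> could thus never
    activate all of \<open>X t\<close>.\<close>
  have "hull_closed G \<tau> (verts G - V \<union> H Y)"
    unfolding hull_closed_def
  proof (intro ballI impI)
    fix u assume u: "u \<in> verts G" "\<tau> u \<le> int (card ((verts G - V \<union> H Y) \<inter> nbhd G u))"
    show "u \<in> verts G - V \<union> H Y"
    proof (cases "u \<in> V \<and> u \<notin> Y")
      case True
      then have "(verts G - V \<union> H Y) \<inter> nbhd G u = H Y \<inter> nbhd G u" using nb by blast
      then show ?thesis using u HY(3) unfolding hull_closed_def by simp
    next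
      case False
      then show ?thesis using u(1) HY(2) by blast
    qed
  qed
  moreover have "M \<subseteq> verts G - V \<union> H Y" using M sub by (auto simp: dynamic_monopoly_def)
  ultimately have "H M \<subseteq> verts G - V \<union> H Y"
    using hull_is_smallest(4)[OF G] M HY(1) by (metis Diff_subset Un_least dynamic_monopoly_def)
  then have "V \<subseteq> H Y" using M V unfolding dynamic_monopoly_def by blast
  moreover have "X t \<subseteq> V" using own(1)[OF t] t A unfolding V_def by blast
  ultimately show False using notin unfolding Y_def by blast
qed

text \<open>The hypothesis on \<open>p\<close> encodes that \<open>t\<close> is a leaf: all
  remaining neighbours of \<open>t\<close> have to equal the one value \<open>p\<close>.\<close>

lemma pruned_step:
  assumes pruned: "pruned A D" and t: "t \<in> A"
    and p: "\<And>q. q \<in> A \<Longrightarrow> {t, q} \<in> edges T \<Longrightarrow> p = Some q"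
    and p': "\<And>q. p = Some q \<Longrightarrow> q \<in> A - {t}"
  shows "pruned (A - {t}) (if X t \<subseteq> H (D \<union> case_option {} X p) then D else D \<union> X t)"
proof -
  define E where "E = (if X t \<subseteq> H (D \<union> case_option {} X p) then D else D \<union> X t)"
  have DE: "D \<subseteq> E" unfolding E_def by simp
  from pruned obtain own k where att: "attached A own D"
    and k: "int (card D) \<le> (width T X + 1) * int k"
      "\<And>M. dynamic_monopoly G \<tau> M \<Longrightarrow> k \<le> card (M \<inter> H D)"
    unfolding pruned_def by blast
  \<comment> \<open>The whole part that hung on \<open>t\<close> is handed over to the
    parent.\<close>
  define own' where "own' s = (if own s = Some t then p else own s)" for s
  have A: "A \<subseteq> verts T" and D: "D \<subseteq> verts G" using att by (auto simp: attached_def)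
  have own: "\<And>a. a \<in> A \<Longrightarrow> own a = Some a" "\<And>s a. own s = Some a \<Longrightarrow> a \<in> A"
    "\<And>s s'. {s, s'} \<in> edges T \<Longrightarrow> s \<notin> A \<Longrightarrow> own s' = own s"
    "\<And>s. s \<in> verts T \<Longrightarrow> X s \<subseteq> H (D \<union> case_option {} X (own s))"
    using att unfolding attached_def by blast+
  have tT: "t \<in> verts T" using A t by blast
  have E: "E \<subseteq> verts G" using D bag_subset[OF tT] unfolding E_def by auto
  have pY: "case_option {} X p \<subseteq> verts G"
    using p' A bag_subset by (cases p) auto
  have mono: "H (D \<union> Z) \<subseteq> H (E \<union> Z)" for Z using DE by (intro hull_mono) auto
  \<comment> \<open>This is the common effect of both branches: either \<open>X t\<close> passed the
    test, or it is now a subset of \<open>E\<close>.\<close>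
  have Xt: "X t \<subseteq> H (E \<union> case_option {} X p)"
    using hull_extensive[of "E \<union> case_option {} X p" G \<tau>] hull_mono[of "D \<union> case_option {} X p" "E \<union> case_option {} X p" G \<tau>]
    unfolding E_def by (auto split: if_splits)
  \<comment> \<open>Whatever was controlled by \<open>X t\<close> becomes controlled by
    \<open>X p\<close>, because \<open>X t\<close> itself has entered the hull around
    \<open>p\<close>.\<close>
  have absorb: "H (D \<union> X t) \<subseteq> H (E \<union> case_option {} X p)"
  proof (rule hull_subset_hull[OF G])
    show "E \<union> case_option {} X p \<subseteq> verts G" using E pY by blast
    show "D \<union> X t \<subseteq> H (E \<union> case_option {} X p)"
      using Xt hull_extensive[of "E \<union> case_option {} X p" G \<tau>] DE by blast
  qed
  have "attached (A - {t}) own' E"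
    unfolding attached_def
  proof (intro conjI ballI allI impI)
    show "A - {t} \<subseteq> verts T" using A by blast
    show "E \<subseteq> verts G" by (rule E)
    show "own' a = Some a" if "a \<in> A - {t}" for a
      using own(1) that by (simp add: own'_def)
    show "a \<in> A - {t}" if "own' s = Some a" for s a
      using own(2)[of s a] that p' by (auto simp: own'_def own(1)[OF t] split: if_splits)
    show "own' s' = own' s" if e: "{s, s'} \<in> edges T \<and> s \<notin> A - {t}" for s s'
    proof (cases "s \<in> A")
      case False
      then show ?thesis using own(3)[of s s'] e by (simp add: own'_def)
    next
      case True
      then have s: "s = t" "own t = Some t" using e own(1)[OF t] by auto
      show ?thesis
      proof (cases "s' \<in> A")
        case True
        then have "p = Some s'" using p e s by blast
        then show ?thesis using s own(1)[OF True] by (simp add: own'_def)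
      next
        case False
        then have "own s = own s'" using own(3)[of s' s] e by (simp add: insert_commute)
        then show ?thesis by (simp add: own'_def)
      qed
    qed
    show "X s \<subseteq> H (E \<union> case_option {} X (own' s))" if "s \<in> verts T" for s
    proof (cases "own s = Some t")
      case True
      then have "X s \<subseteq> H (D \<union> X t)" using own(4)[OF that] by (simp only: option.case)
      also note absorb
      finally show ?thesis by (simp only: own'_def True refl if_True)
    next
      case False
      note own(4)[OF that]
      also note mono[of "case_option {} X (own s)"]
      finally show ?thesis by (simp only: own'_def False if_False)
    qed
  qed
  moreover have "\<exists>k. int (card E) \<le> (width T X + 1) * int k \<and>
        (\<forall>M. dynamic_monopoly G \<tau> M \<longrightarrow> k \<le> card (M \<inter> H E))"
  proof (cases "X t \<subseteq> H (D \<union> case_option {} X p)")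
    case True
    then show ?thesis using k unfolding E_def by (auto intro!: exI[of _ k])
  next
    case False
    then have E_eq: "E = D \<union> X t" by (simp add: E_def)
    have "int (card E) \<le> int (card D) + int (card (X t))"
      unfolding E_eq by (metis card_Un_le of_nat_add of_nat_mono)
    also have "\<dots> \<le> (width T X + 1) * int (Suc k)"
      using k(1) bag_card[OF tT] by (simp add: algebra_simps)
    finally have "int (card E) \<le> (width T X + 1) * int (Suc k)" .
    moreover have "Suc k \<le> card (M \<inter> H E)" if M: "dynamic_monopoly G \<tau> M" for M
    proof -
      obtain u s where u: "u \<in> M" "u \<notin> H (D \<union> case_option {} X p)"
        and s: "s \<in> verts T" "own s = Some t" "u \<in> X s"
        using monopoly_hits_pruned_part[OF att t p _ False M] p' by blast
      have "X s \<subseteq> H (D \<union> X t)" using own(4)[OF s(1)] s(2) by simp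
      then have "u \<in> H E" using s(3) E_eq by (simp only: subset_iff)
      \<comment> \<open>So \<open>u\<close> is new in \<open>M \<inter> H E\<close>, and no vertex
        charged earlier can be charged a second time.\<close>
      moreover have "u \<notin> H D" using u(2) hull_mono[of D "D \<union> case_option {} X p" G \<tau>] by blast
      moreover have "M \<inter> H D \<subseteq> M \<inter> H E" using mono[of "{}"] by auto
      ultimately have "M \<inter> H D \<subset> M \<inter> H E" using u(1) by blast
      moreover have "finite M" using M finite_verts(1) finite_subset unfolding dynamic_monopoly_def by blast
      ultimately have "card (M \<inter> H D) < card (M \<inter> H E)" by (simp add: psubset_card_mono)
      then show ?thesis using k(2)[OF M] by simp
    qed
    ultimately show ?thesis by blast
  qed
  ultimately have "pruned (A - {t}) E"
    unfolding pruned_def by (intro conjI exI[of _ own'])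
  then show ?thesis unfolding E_def .
qed

end

section \<open>Reasoning about programs and their running time\<close>

text \<open>A total-correctness triple with an upper bound on the time. Since \<open>exec\<close> is
  deterministic, asking for one execution already describes the execution.\<close>

definition runs :: "com \<Rightarrow> store \<Rightarrow> nat \<Rightarrow> (store \<Rightarrow> bool) \<Rightarrow> bool" where
  "runs c s k Q \<longleftrightarrow> (\<exists>t s'. exec c s t s' \<and> t \<le> k \<and> Q s')"

lemma runs_mono: "runs c s k Q \<Longrightarrow> k \<le> k' \<Longrightarrow> (\<And>s'. Q s' \<Longrightarrow> Q' s') \<Longrightarrow> runs c s k' Q'"
  unfolding runs_def by (meson order_trans)

lemma runs_Seq:
  assumes "runs c s k (\<lambda>s'. runs d s' l Q)"
  shows "runs (c ;; d) s (k + l) Q"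
  using assms unfolding runs_def by (meson add_mono exec_Seq)

lemma runs_If:
  assumes "bval b s \<Longrightarrow> runs c s k Q" "\<not> bval b s \<Longrightarrow> runs d s k Q"
  shows "runs (If b c d) s (1 + bcost b + k) Q"
  using assms unfolding runs_def
  by (cases "bval b s") (meson add_left_mono exec_IfTrue, meson add_left_mono exec_IfFalse)

fun writes :: "com \<Rightarrow> string set" where
  "writes Skip = {}"
| "writes (a[e] ::= f) = {a}"
| "writes (c ;; d) = writes c \<union> writes d"
| "writes (If b c d) = writes c \<union> writes d"
| "writes (While b c) = writes c"

lemma exec_frame: "exec c s t s' \<Longrightarrow> a \<notin> writes c \<Longrightarrow> s' a = s a"
  by (induction rule: exec.induct) auto

lemma runs_frame:
  assumes "runs c s k Q"
  shows "runs c s k (\<lambda>s'. Q s' \<and> (\<forall>a. a \<notin> writes c \<longrightarrow> s' a = s a))"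
  using assms exec_frame unfolding runs_def by blast

fun loopfree :: "com \<Rightarrow> bool" where
  "loopfree (c ;; d) \<longleftrightarrow> loopfree c \<and> loopfree d"
| "loopfree (If b c d) \<longleftrightarrow> loopfree c \<and> loopfree d"
| "loopfree (While b c) \<longleftrightarrow> False"
| "loopfree c \<longleftrightarrow> True"

text \<open>A simplifier-friendly semantics for straight-line code. The last equation also applies
  to \<open>While\<close>, where it means nothing; \<open>run\<close> and \<open>maxcost\<close> are
  linked to \<open>exec\<close> only under \<open>loopfree\<close>.\<close>

fun run :: "com \<Rightarrow> store \<Rightarrow> store" where
  "run (a[e] ::= f) s = s(a := (s a)(aval e s := aval f s))"
| "run (c ;; d) s = run d (run c s)"
| "run (If b c d) s = (if bval b s then run c s else run d s)"
| "run c s = s"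

fun maxcost :: "com \<Rightarrow> nat" where
  "maxcost (a[e] ::= f) = 1 + acost e + acost f"
| "maxcost (c ;; d) = maxcost c + maxcost d"
| "maxcost (If b c d) = 1 + bcost b + max (maxcost c) (maxcost d)"
| "maxcost c = 1"

lemma runs_loopfree: "loopfree c \<Longrightarrow> Q (run c s) \<Longrightarrow> runs c s (maxcost c) Q"
proof (induction c arbitrary: s Q)
  case (Seq c d)
  then show ?case by (auto intro: runs_Seq)
next
  case (If b c d)
  have "runs (If b c d) s (1 + bcost b + max (maxcost c) (maxcost d)) Q"
  proof (rule runs_If)
    assume "bval b s"
    with If.prems have "runs c s (maxcost c) Q" by (intro If.IH(1)) simp_all
    then show "runs c s (max (maxcost c) (maxcost d)) Q" by (rule runs_mono) simp_all
  next
    assume "\<not> bval b s"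
    with If.prems have "runs d s (maxcost d) Q" by (intro If.IH(2)) simp_all
    then show "runs d s (max (maxcost c) (maxcost d)) Q" by (rule runs_mono) simp_all
  qed
  then show ?case by simp
qed (force simp: runs_def intro: exec.intros)+

abbreviation V :: "string \<Rightarrow> aexp" where "V x \<equiv> Arr x (Const 0)"
abbreviation set_var :: "string \<Rightarrow> aexp \<Rightarrow> com"  (\<open>_ <- _\<close> [1000, 61] 61) where
  "x <- e \<equiv> x[Const 0] ::= e"
abbreviation "Eq e f \<equiv> And (Neg (Less e f)) (Neg (Less f e))"

definition For :: "string \<Rightarrow> aexp \<Rightarrow> aexp \<Rightarrow> com \<Rightarrow> com" where
  "For x lo hi c = (x <- lo ;; While (Less (V x) hi) (c ;; x <- Plus (V x) (Const 1)))"

lemma writes_For [simp]: "writes (For x lo hi c) = insert x (writes c)"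
  by (auto simp: For_def)

text \<open>The factor \<open>Suc l\<close> also pays for the initialisation and the final test.\<close>

lemma runs_For:
  assumes lo: "aval lo s = a"
    and start: "I 0 (s(x := (s x)(0 := a)))"
    and step: "\<And>k s'. \<lbrakk>k < l; I k s'; s' x 0 = a + int k;
        \<And>b. b \<notin> insert x (writes c) \<Longrightarrow> s' b = s b\<rbrakk> \<Longrightarrow>
        runs c s' B (\<lambda>s''. s'' x 0 = a + int k \<and> I (Suc k) (s''(x := (s'' x)(0 := a + int k + 1))))"
    and hi: "\<And>s'. (\<And>b. b \<notin> insert x (writes c) \<Longrightarrow> s' b = s b) \<Longrightarrow> aval hi s' = a + int l"
  shows "runs (For x lo hi c) s (Suc l * (B + acost lo + acost hi + 14))
    (\<lambda>s'. I l s' \<and> (\<forall>b. b \<notin> insert x (writes c) \<longrightarrow> s' b = s b))"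
proof -
  let ?while = "While (Less (V x) hi) (c ;; x <- Plus (V x) (Const 1))"
  let ?J = "\<lambda>k s'. I k s' \<and> s' x 0 = a + int k \<and> (\<forall>b. b \<notin> insert x (writes c) \<longrightarrow> s' b = s b)"
  \<comment> \<open>Induction on the number of rounds left. A round takes at most \<open>B\<close>
    for the body, 6 for the increment and \<open>4 + acost hi\<close> for the test, so 12 contains
    some slack; the trailing \<open>acost hi + 12\<close> pays for the failing test.\<close>
  have loop: "runs ?while s' ((l - k) * (B + acost hi + 12) + acost hi + 12) (?J l)"
    if "?J k s'" "k \<le> l" for k s'
    using that
  proof (induction "l - k" arbitrary: k s')
    case 0
    then have "k = l" by simp
    with 0 hi[of s'] have b: "\<not> bval (Less (V x) hi) s'" and J: "?J l s'" by auto
    from b have "exec ?while s' (1 + bcost (Less (V x) hi)) s'" by (rule exec_WhileFalse)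
    moreover have "1 + bcost (Less (V x) hi) \<le> (l - k) * (B + acost hi + 12) + acost hi + 12"
      by simp
    ultimately show ?case using J unfolding runs_def by blast
  next
    case (Suc d)
    then have k: "k < l" by simp
    have b: "bval (Less (V x) hi) s'" using hi[of s'] Suc.prems(1) k by simp
    from step[of k s'] Suc.prems k
    have "runs c s' B (\<lambda>s''. s'' x 0 = a + int k \<and> I (Suc k) (s''(x := (s'' x)(0 := a + int k + 1))))"
      by blast
    from runs_frame[OF this] obtain t s'' where c: "exec c s' t s''" "t \<le> B" "s'' x 0 = a + int k"
      "I (Suc k) (s''(x := (s'' x)(0 := a + int k + 1)))" "\<And>b. b \<notin> writes c \<Longrightarrow> s'' b = s' b"
      unfolding runs_def by blast
    let ?s = "s''(x := (s'' x)(0 := a + int k + 1))"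
    have inc: "exec (x <- Plus (V x) (Const 1)) s'' 6 ?s"
      using exec_Assign[of x "Const 0" "Plus (V x) (Const 1)" s''] c(3) by (simp add: numeral_eq_Suc)
    have "runs ?while ?s ((l - Suc k) * (B + acost hi + 12) + acost hi + 12) (?J l)"
      using Suc.prems c k Suc.hyps(2) by (intro Suc.hyps(1)) auto
    then obtain t' s3 where w: "exec ?while ?s t' s3" "?J l s3"
      "t' \<le> (l - Suc k) * (B + acost hi + 12) + acost hi + 12"
      unfolding runs_def by blast
    have "l - k = Suc (l - Suc k)" using k by simp
    then have "1 + bcost (Less (V x) hi) + (t + 6) + t' \<le>
        (l - k) * (B + acost hi + 12) + acost hi + 12"
      using w(3) c(2) by simp
    moreover note exec_WhileTrue[OF b exec_Seq[OF c(1) inc] w(1)] w(2)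
    ultimately show ?case unfolding runs_def by metis
  qed
  let ?s = "s(x := (s x)(0 := a))"
  have "runs (x <- lo) s (2 + acost lo) (\<lambda>s'. s' = ?s)"
    using exec_Assign[of x "Const 0" lo s] lo unfolding runs_def by auto
  moreover have "runs ?while ?s (l * (B + acost hi + 12) + acost hi + 12) (?J l)"
    using start loop[of 0 ?s] by auto
  ultimately have "runs (For x lo hi c) s (2 + acost lo + (l * (B + acost hi + 12) + acost hi + 12)) (?J l)"
    unfolding For_def by (intro runs_Seq) (auto elim: runs_mono)
  then show ?thesis
    by (rule runs_mono) (auto simp: algebra_simps)
qed

text \<open>The bound \<open>B\<close> is left free so that every innermost loop of the program can
  be charged the same round figure 100 per iteration.\<close>

lemma runs_For_loopfree:
  assumes "loopfree c" and "aval lo s = a" and "I 0 (s(x := (s x)(0 := a)))"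
    and step: "\<And>k s'. \<lbrakk>k < l; I k s'; s' x 0 = a + int k;
        \<And>b. b \<notin> insert x (writes c) \<Longrightarrow> s' b = s b\<rbrakk> \<Longrightarrow>
        I (Suc k) ((run c s')(x := (run c s' x)(0 := a + int k + 1)))"
    and "x \<notin> writes c"
    and "\<And>s'. (\<And>b. b \<notin> insert x (writes c) \<Longrightarrow> s' b = s b) \<Longrightarrow> aval hi s' = a + int l"
    and B: "maxcost c + acost lo + acost hi + 14 \<le> B"
    and Q: "\<And>s'. I l s' \<Longrightarrow> Q s'"
  shows "runs (For x lo hi c) s (Suc l * B) Q"
proof -
  have "run c s' x = s' x" for s'
    using runs_frame[OF runs_loopfree[of c "\<lambda>s''. s'' = run c s'"]] assms(1) \<open>x \<notin> writes c\<close>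
    unfolding runs_def by blast
  note same = this
  have "runs (For x lo hi c) s (Suc l * (maxcost c + acost lo + acost hi + 14))
    (\<lambda>s'. I l s' \<and> (\<forall>b. b \<notin> insert x (writes c) \<longrightarrow> s' b = s b))"
  proof (rule runs_For[of lo s a I x l c "maxcost c" hi])
    fix k s' assume k: "k < l" "I k s'" "s' x 0 = a + int k"
      "\<And>b. b \<notin> insert x (writes c) \<Longrightarrow> s' b = s b"
    show "runs c s' (maxcost c) (\<lambda>s''. s'' x 0 = a + int k \<and>
        I (Suc k) (s''(x := (s'' x)(0 := a + int k + 1))))"
      using step[OF k] k(3) same[of s'] by (intro runs_loopfree[OF assms(1)]) simp
  qed (use assms in blast)+
  then show ?thesis
    using B Q by (elim runs_mono) (auto intro: mult_le_mono simp del: mult_Suc)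
qed

lemma runs_SeqI:
  assumes "runs c s k P"
    and "\<And>s'. P s' \<Longrightarrow> (\<And>a. a \<notin> writes c \<Longrightarrow> s' a = s a) \<Longrightarrow> runs d s' l Q"
  shows "runs (c ;; d) s (k + l) Q"
  using assms(2) by (intro runs_Seq runs_mono[OF runs_frame[OF assms(1)]]) auto

section \<open>The program\<close>

definition init_degrees :: com where
  "init_degrees = For ''j'' (Const 0) (V ''nodes'') (''deg''[V ''j''] ::= Const 0)"

definition count_degrees :: com where
  "count_degrees = For ''j'' (Const 0) (V ''links'')
      (If (And (Less (Arr ''dead'' (Arr ''tu'' (V ''j''))) (Const 1))
               (Less (Arr ''dead'' (Arr ''tv'' (V ''j''))) (Const 1)))
        (''deg''[Arr ''tu'' (V ''j'')] ::= Plus (Arr ''deg'' (Arr ''tu'' (V ''j''))) (Const 1) ;;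
         ''deg''[Arr ''tv'' (V ''j'')] ::= Plus (Arr ''deg'' (Arr ''tv'' (V ''j''))) (Const 1))
        Skip)"

definition pick_leaf :: com where
  "pick_leaf = For ''j'' (Const 0) (V ''nodes'')
      (If (And (Less (Arr ''dead'' (V ''j'')) (Const 1)) (Less (Arr ''deg'' (V ''j'')) (Const 2)))
        (''t'' <- V ''j'') Skip)"

definition find_parent :: com where
  "find_parent =
    ''p'' <- Const (- 1) ;;
    For ''j'' (Const 0) (V ''links'')
      (If (And (Eq (Arr ''tu'' (V ''j'')) (V ''t'')) (Less (Arr ''dead'' (Arr ''tv'' (V ''j''))) (Const 1)))
        (''p'' <- Arr ''tv'' (V ''j''))
      (If (And (Eq (Arr ''tv'' (V ''j'')) (V ''t'')) (Less (Arr ''dead'' (Arr ''tu'' (V ''j''))) (Const 1)))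
        (''p'' <- Arr ''tu'' (V ''j''))
        Skip))"

definition load_hull :: com where
  "load_hull = For ''j'' (Const 0) (V ''n'')
     (''c''[V ''j''] ::= Arr ''tau'' (V ''j'') ;;
      ''h''[V ''j''] ::= Arr ''out'' (V ''j'') ;;
      ''q''[V ''j''] ::= Const (- 1))"

definition load_bag :: "string \<Rightarrow> string \<Rightarrow> com" where
  "load_bag a x = For ''j'' (Arr ''start'' (V x)) (Arr ''start'' (Plus (V x) (Const 1)))
     (a[Arr ''bag'' (V ''j'')] ::= Const 1)"

text \<open>Vertices with nonpositive threshold must be queued here: \<open>notify\<close> looks
  only at neighbours of queued vertices and would miss those that have no such neighbour.\<close>

definition init_queue :: com where
  "init_queue = ''tail'' <- Const 0 ;; For ''j'' (Const 0) (V ''n'')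
     (If (And (Less (Arr ''h'' (V ''j'')) (Const 1)) (Less (Const 0) (Arr ''c'' (V ''j''))))
        Skip
        (''h''[V ''j''] ::= Const 1 ;;
         ''q''[V ''tail''] ::= V ''j'' ;;
         ''tail'' <- Plus (V ''tail'') (Const 1)))"

definition notify :: com where
  "notify =
     ''c''[V ''w''] ::= Minus (Arr ''c'' (V ''w'')) (Const 1) ;;
     If (And (Less (Arr ''c'' (V ''w'')) (Const 1)) (Less (Arr ''h'' (V ''w'')) (Const 1)))
       (''h''[V ''w''] ::= Const 1 ;;
        ''q''[V ''tail''] ::= V ''w'' ;;
        ''tail'' <- Plus (V ''tail'') (Const 1))
       Skip"

definition other_end :: com where
  "other_end =
     If (Eq (Arr ''eu'' (V ''j'')) (V ''v'')) (''w'' <- Arr ''ev'' (V ''j''))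
     (If (Eq (Arr ''ev'' (V ''j'')) (V ''v'')) (''w'' <- Arr ''eu'' (V ''j''))
     (''w'' <- Const (- 1)))"

text \<open>Unused queue cells hold \<open>-1\<close>, which is the end of no edge, so that the loop over the
  queue need not stop at its tail.\<close>

definition scan_edges :: com where
  "scan_edges = For ''j'' (Const 0) (V ''m'')
     (other_end ;; If (Less (V ''w'') (Const 0)) Skip notify)"

definition run_queue :: com where
  "run_queue = For ''i'' (Const 0) (V ''n'') (''v'' <- Arr ''q'' (V ''i'') ;; scan_edges)"

definition search :: com where
  "search = init_degrees ;; count_degrees ;; pick_leaf ;; find_parent"

definition compute_hull :: com where
  "compute_hull = load_hull ;; load_bag ''h'' ''p'' ;; init_queue ;; run_queue"

definition check_bag :: com where
  "check_bag = ''f'' <- Const 0 ;;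
    For ''j'' (Arr ''start'' (V ''t'')) (Arr ''start'' (Plus (V ''t'') (Const 1)))
      (If (Less (Arr ''h'' (Arr ''bag'' (V ''j''))) (Const 1)) (''f'' <- Const 1) Skip)"

definition prune_leaf :: com where
  "prune_leaf = search ;; (compute_hull ;; (check_bag ;;
    (If (Less (Const 0) (V ''f'')) (load_bag ''out'' ''t'') Skip ;;
    ''dead''[V ''t''] ::= Const 1)))"

definition approximate_dyn :: com where
  "approximate_dyn = For ''k'' (Const 0) (V ''nodes'') prune_leaf"

lemmas loop_defs = init_degrees_def count_degrees_def pick_leaf_def find_parent_def
  load_hull_def load_bag_def init_queue_def scan_edges_def other_end_def notify_def run_queue_def
  search_def compute_hull_def check_bag_def prune_leaf_def

section \<open>Correctness and running time\<close>

locale coded_decomposition = decomposed_graph G \<tau> T X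
  for G :: "nat graph" and \<tau> :: "nat \<Rightarrow> int" and T :: "nat graph" and X :: "nat \<Rightarrow> nat set" +
  fixes es fs :: "(nat \<times> nat) list" and Xs :: "nat list list"
  assumes es: "graph_code G es" and fs: "graph_code T fs" and Xs: "bags_code T X Xs"
begin

abbreviation n where "n \<equiv> card (verts G)"
abbreviation m where "m \<equiv> length es"
abbreviation N where "N \<equiv> card (verts T)"
abbreviation L where "L \<equiv> length fs"
abbreviation ES where "ES \<equiv> map (\<lambda>(u, v). {u, v}) es"
abbreviation FS where "FS \<equiv> map (\<lambda>(u, v). {u, v}) fs"

lemma verts_eq: "verts G = {..<n}" "verts T = {..<N}"
  using es fs unfolding graph_code_def by blast+

lemma in_verts: "u \<in> verts G \<longleftrightarrow> u < n" "t \<in> verts T \<longleftrightarrow> t < N"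
  using verts_eq by (metis lessThan_iff)+

lemma edges_eq: "edges G = set ES" "edges T = set FS" "distinct ES" "distinct FS"
  using es fs unfolding graph_code_def by blast+

lemma m_eq: "card (edges G) = m" and L_eq: "card (edges T) = L"
  using edges_eq by (metis distinct_card length_map)+

lemma L_le: "L \<le> N"
  using forest_card_edges[OF T acyclic] L_eq by simp

lemma edge_nth:
  assumes "j < m"
  shows "fst (es ! j) < n" "snd (es ! j) < n" "fst (es ! j) \<noteq> snd (es ! j)"
    "ES ! j = {fst (es ! j), snd (es ! j)}" "{fst (es ! j), snd (es ! j)} \<in> edges G"
proof -
  show *: "ES ! j = {fst (es ! j), snd (es ! j)}" using assms by (simp add: case_prod_beta)
  then show e: "{fst (es ! j), snd (es ! j)} \<in> edges G"
    using assms nth_mem[of j ES] unfolding edges_eq(1) by (simp only: length_map)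
  then have "{fst (es ! j), snd (es ! j)} \<subseteq> verts G" "card {fst (es ! j), snd (es ! j)} = 2"
    using G unfolding simple_graph_def by blast+
  then show "fst (es ! j) < n" "snd (es ! j) < n" "fst (es ! j) \<noteq> snd (es ! j)"
    using in_verts(1) by (auto simp: card_insert_if split: if_splits)
qed

lemma link_nth:
  assumes "j < L"
  shows "fst (fs ! j) < N" "snd (fs ! j) < N" "fst (fs ! j) \<noteq> snd (fs ! j)"
    "FS ! j = {fst (fs ! j), snd (fs ! j)}" "{fst (fs ! j), snd (fs ! j)} \<in> edges T"
proof -
  show *: "FS ! j = {fst (fs ! j), snd (fs ! j)}" using assms by (simp add: case_prod_beta)
  then show e: "{fst (fs ! j), snd (fs ! j)} \<in> edges T"
    using assms nth_mem[of j FS] unfolding edges_eq(2) by (simp only: length_map)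
  then have "{fst (fs ! j), snd (fs ! j)} \<subseteq> verts T" "card {fst (fs ! j), snd (fs ! j)} = 2"
    using T unfolding simple_graph_def by blast+
  then show "fst (fs ! j) < N" "snd (fs ! j) < N" "fst (fs ! j) \<noteq> snd (fs ! j)"
    using in_verts(2) by (auto simp: card_insert_if split: if_splits)
qed

section \<open>Reading the encoded input\<close>

definition inputs :: "string set" where
  "inputs = {''n'', ''m'', ''eu'', ''ev'', ''tau'', ''nodes'', ''links'', ''tu'', ''tv'', ''start'', ''bag''}"

definition inp :: "store \<Rightarrow> bool" where
  "inp s \<longleftrightarrow> (\<forall>a\<in>inputs. s a = input_store G es \<tau> T fs Xs a)"

lemma inp_frame: "inp s \<Longrightarrow> (\<And>a. a \<in> inputs \<Longrightarrow> s' a = s a) \<Longrightarrow> inp s'"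
  unfolding inp_def by auto

lemma inp_simps:
  assumes "inp s"
  shows "s ''n'' 0 = int n" "s ''m'' 0 = int m" "s ''nodes'' 0 = int N" "s ''links'' 0 = int L"
    and "\<And>j. j < m \<Longrightarrow> s ''eu'' (int j) = int (fst (es ! j))"
    and "\<And>j. j < m \<Longrightarrow> s ''ev'' (int j) = int (snd (es ! j))"
    and "\<And>j. j < L \<Longrightarrow> s ''tu'' (int j) = int (fst (fs ! j))"
    and "\<And>j. j < L \<Longrightarrow> s ''tv'' (int j) = int (snd (fs ! j))"
    and "\<And>v. v < n \<Longrightarrow> s ''tau'' (int v) = \<tau> v"
  using assms unfolding inp_def inputs_def input_store_def array_def
  by (simp_all add: case_prod_beta)

text \<open>Since all memory outside the input is zero, \<open>-1\<close> encodes a node with an empty bag.\<close>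

definition bag_list :: "int \<Rightarrow> nat list" where
  "bag_list p = (if p < 0 then [] else Xs ! nat p)"

lemma bag_list_start:
  assumes "inp s" "- 1 \<le> p" "p < int N"
  shows "s ''start'' (p + 1) = s ''start'' p + int (length (bag_list p))"
proof -
  have len: "length Xs = N" using Xs by (simp add: bags_code_def)
  have start: "s ''start'' = array (map (\<lambda>t. int (length (concat (take t Xs)))) [0..<Suc (length Xs)])"
    using assms(1) unfolding inp_def inputs_def input_store_def by simp
  show ?thesis
  proof (cases "p = -1")
    \<comment> \<open>Both \<open>start[-1]\<close>, which lies outside the array, and the first
      offset \<open>start[0]\<close> are 0, so the range of positions is empty.\<close>
    case True
    then show ?thesis unfolding start by (simp add: array_def bag_list_def del: upt_Suc)
  next
    case False
    then obtain t where t: "p = int t" "t < N" using assms(2,3) by (cases p) auto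
    then have "nat (1 + int t) = Suc t" by simp
    then show ?thesis using t len unfolding start
      by (simp add: array_def bag_list_def take_Suc_conv_app_nth add.commute del: upt_Suc)
  qed
qed

lemma bag_list_elem:
  assumes "inp s" "p < int N" "k < length (bag_list p)"
  shows "s ''bag'' (s ''start'' p + int k) = int (bag_list p ! k)"
proof -
  have len: "length Xs = N" using Xs by (simp add: bags_code_def)
  obtain t where t: "p = int t" "t < N" "k < length (Xs ! t)"
    using assms(2,3) by (cases p) (auto simp: bag_list_def)
  have start: "s ''start'' p = int (length (concat (take t Xs)))"
    using assms(1) t len unfolding inp_def inputs_def input_store_def
    by (simp add: array_def del: upt_Suc)
  have "concat Xs = concat (take t Xs) @ Xs ! t @ concat (drop (Suc t) Xs)"
    using t(2) len by (metis append.assoc concat.simps(2) concat_append id_take_nth_drop)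
  then have "concat Xs ! (length (concat (take t Xs)) + k) = Xs ! t ! k"
    "length (concat (take t Xs)) + k < length (concat Xs)"
    using t(3) by (simp_all add: nth_append)
  moreover have "s ''bag'' = array (map int (concat Xs))"
    using assms(1) unfolding inp_def inputs_def input_store_def by simp
  ultimately show ?thesis unfolding start
    by (simp add: array_def bag_list_def t(1) nat_int_add del: length_concat)
qed

lemma set_bag_list: "p < int N \<Longrightarrow> set (bag_list p) = case_option {} X (if p < 0 then None else Some (nat p))"
  using Xs by (auto simp: bags_code_def bag_list_def)

lemma bag_list_verts:
  assumes "p < int N" "u \<in> set (bag_list p)"
  shows "u < n"
proof -
  have "u \<in> X (nat p)" "nat p < N"
    using assms unfolding set_bag_list[OF assms(1)] by (auto split: if_splits)
  then show ?thesis using bag_subset[of "nat p"] in_verts by blast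
qed

lemma bag_list_length: "p < int N \<Longrightarrow> length (bag_list p) \<le> n"
proof -
  assume p: "p < int N"
  have "distinct (bag_list p)" using Xs p by (auto simp: bags_code_def bag_list_def)
  then show ?thesis using card_mono[of "{..<n}" "set (bag_list p)"] bag_list_verts[OF p]
    by (simp add: distinct_card subset_iff)
qed

section \<open>Finding a leaf and its remaining neighbour\<close>

definition degree_upto :: "nat set \<Rightarrow> nat \<Rightarrow> nat \<Rightarrow> nat" where
  "degree_upto A k x = length (filter (\<lambda>e. x \<in> e \<and> e \<subseteq> A) (take k FS))"

lemma degree_upto_Suc:
  "k < L \<Longrightarrow> degree_upto A (Suc k) x = degree_upto A k x +
    of_bool ((x = fst (fs ! k) \<or> x = snd (fs ! k)) \<and> fst (fs ! k) \<in> A \<and> snd (fs ! k) \<in> A)"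
  using link_nth(4)[of k] by (auto simp: degree_upto_def take_Suc_conv_app_nth case_prod_beta)

lemma degree_upto_L: "degree_upto A L x = card {e \<in> edges T. x \<in> e \<and> e \<subseteq> A}"
proof -
  have "distinct (filter (\<lambda>e. x \<in> e \<and> e \<subseteq> A) FS)" using edges_eq(4) by simp
  from distinct_card[OF this] show ?thesis
    unfolding degree_upto_def edges_eq(2) set_filter by simp
qed

lemma runs_init_degrees:
  assumes "inp s"
  shows "runs init_degrees s (Suc N * 100) (\<lambda>s'. \<forall>x<N. s' ''deg'' (int x) = 0)"
  unfolding init_degrees_def
proof (rule runs_For_loopfree[where I = "\<lambda>k s. \<forall>x<k. s ''deg'' (int x) = 0"
        and l = N and a = 0], goal_cases)
  case (4 k s')
  show ?case using 4(2,3) by (auto simp: less_Suc_eq)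
qed (use inp_simps[OF assms] in auto)

lemma runs_count_degrees:
  assumes "inp s" and deg: "\<forall>x<N. s ''deg'' (int x) = 0"
    and dead: "\<And>x. x < N \<Longrightarrow> s ''dead'' (int x) = of_bool (x \<notin> A)"
  shows "runs count_degrees s (Suc L * 100)
    (\<lambda>s'. \<forall>x<N. s' ''deg'' (int x) = int (degree_upto A L x))"
  unfolding count_degrees_def
proof (rule runs_For_loopfree
      [where I = "\<lambda>k s. \<forall>x<N. s ''deg'' (int x) = int (degree_upto A k x)" and l = L and a = 0], goal_cases)
  case 3
  then show ?case using deg by (simp add: degree_upto_def)
next
  case (4 k s')
  have "inp s'" using assms(1) by (rule inp_frame, intro 4(4)) (auto simp: inputs_def)
  moreover have "s' ''dead'' = s ''dead''" using 4(4) by simp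
  ultimately show ?case
    using 4(1-3) link_nth[OF 4(1)] dead by (auto simp: inp_simps degree_upto_Suc)
qed (use inp_simps[OF assms(1)] in auto)

text \<open>The loop invariant is conditional: \<open>t\<close> is a leaf as soon as a leaf has been
  seen. Acyclicity of the tree discharges the condition only after the loop.\<close>

lemma runs_pick_leaf:
  assumes "inp s" and A: "A \<subseteq> {..<N}" "A \<noteq> {}"
    and deg: "\<forall>x<N. s ''deg'' (int x) = int (degree_upto A L x)"
    and dead: "\<And>x. x < N \<Longrightarrow> s ''dead'' (int x) = of_bool (x \<notin> A)"
  shows "runs pick_leaf s (Suc N * 100)
    (\<lambda>s'. \<exists>t\<in>A. s' ''t'' 0 = int t \<and> card {e \<in> edges T. t \<in> e \<and> e \<subseteq> A} < 2)"
  unfolding pick_leaf_def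
proof (rule runs_For_loopfree
      [where I = "\<lambda>k s. (\<exists>x<k. x \<in> A \<and> degree_upto A L x < 2) \<longrightarrow>
         (\<exists>t\<in>A. s ''t'' 0 = int t \<and> degree_upto A L t < 2)" and l = N and a = 0], goal_cases)
  case (4 k s')
  then have "s' ''dead'' = s ''dead''" "s' ''deg'' = s ''deg''" by simp_all
  then show ?case
    using 4(1-3) dead deg by (auto simp: less_Suc_eq)
next
  case (8 s')
  have "\<exists>x\<in>A. degree_upto A L x < 2"
    unfolding degree_upto_L using A in_verts(2) by (intro forest_exists_leaf[OF T acyclic]) auto
  then have "\<exists>x<N. x \<in> A \<and> degree_upto A L x < 2" using A by blast
  then show ?case using 8 by (simp add: degree_upto_L)
qed (use inp_simps[OF assms(1)] in auto)

lemma runs_find_parent: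
  assumes "inp s" and t: "t < N" "s ''t'' 0 = int t"
    and dead: "\<And>x. x < N \<Longrightarrow> s ''dead'' (int x) = of_bool (x \<notin> A)"
  shows "runs find_parent s (10 + Suc L * 100)
    (\<lambda>s'. (s' ''p'' 0 = - 1 \<and> (\<forall>q\<in>A. {t, q} \<notin> edges T)) \<or>
       (\<exists>q\<in>A. s' ''p'' 0 = int q \<and> {t, q} \<in> edges T))"
  unfolding find_parent_def
proof (rule runs_SeqI)
  show "runs (''p'' <- Const (- 1)) s 10 (\<lambda>s'. s' ''p'' 0 = - 1)"
    by (rule runs_mono[OF runs_loopfree]) auto
next
  fix s1 :: store
  assume p: "s1 ''p'' 0 = - 1" and frame: "\<And>a. a \<notin> writes (''p'' <- Const (- 1)) \<Longrightarrow> s1 a = s a"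
  have "inp s1" using assms(1) by (rule inp_frame, intro frame) (auto simp: inputs_def)
  have s1: "s1 ''t'' = s ''t''" "s1 ''dead'' = s ''dead''" using frame by simp_all
  show "runs (For ''j'' (Const 0) (V ''links'')
      (If (And (Eq (Arr ''tu'' (V ''j'')) (V ''t'')) (Less (Arr ''dead'' (Arr ''tv'' (V ''j''))) (Const 1)))
        (''p'' <- Arr ''tv'' (V ''j''))
      (If (And (Eq (Arr ''tv'' (V ''j'')) (V ''t'')) (Less (Arr ''dead'' (Arr ''tu'' (V ''j''))) (Const 1)))
        (''p'' <- Arr ''tu'' (V ''j''))
        Skip))) s1 (Suc L * 100)
    (\<lambda>s'. (s' ''p'' 0 = - 1 \<and> (\<forall>q\<in>A. {t, q} \<notin> edges T)) \<or>
       (\<exists>q\<in>A. s' ''p'' 0 = int q \<and> {t, q} \<in> edges T))"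
  proof (rule runs_For_loopfree
      [where I = "\<lambda>k s. (s ''p'' 0 = - 1 \<and> (\<forall>q\<in>A. {t, q} \<notin> set (take k FS))) \<or>
       (\<exists>q\<in>A. s ''p'' 0 = int q \<and> {t, q} \<in> edges T)" and l = L and a = 0], goal_cases)
    case (4 k s')
    have i: "inp s'" using \<open>inp s1\<close> by (rule inp_frame, intro 4(4)) (auto simp: inputs_def)
    have s': "s' ''t'' 0 = int t" "s' ''dead'' = s ''dead''" using 4(4) s1 t(2) by simp_all
    let ?a = "fst (fs ! k)" and ?b = "snd (fs ! k)"
    have take: "set (take (Suc k) FS) = insert {?a, ?b} (set (take k FS))"
      using 4(1) link_nth(4)[OF 4(1)] by (simp add: take_Suc_conv_app_nth del: nth_map)
    have vals: "s' ''tu'' (int k) = int ?a" "s' ''tv'' (int k) = int ?b"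
      "s' ''dead'' (int ?a) = of_bool (?a \<notin> A)" "s' ''dead'' (int ?b) = of_bool (?b \<notin> A)"
      using 4(1) inp_simps[OF i] link_nth[OF 4(1)] dead by (simp_all add: s')
    consider "?a = t" "?b \<in> A" | "?b = t" "?a \<in> A" "\<not> (?a = t \<and> ?b \<in> A)"
      | "\<not> (?a = t \<and> ?b \<in> A)" "\<not> (?b = t \<and> ?a \<in> A)" by blast
    then show ?case
    proof cases
      case 1
      then show ?thesis using 4(3) vals s'(1) link_nth(5)[OF 4(1)] by auto
    next
      case 2
      then have "{t, ?a} \<in> edges T" using link_nth(5)[OF 4(1)] by (simp add: insert_commute)
      then show ?thesis using 2 4(3) vals s'(1) by auto
    next
      case 3
      then have "{t, q} \<noteq> {?a, ?b}" if "q \<in> A" for q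
        using that by (auto simp: doubleton_eq_iff)
      then show ?thesis using 3 4(2,3) vals s'(1) unfolding take by auto
    qed
  next
    case (8 s')
    then show ?case unfolding edges_eq(2) by simp
  qed (use inp_simps[OF \<open>inp s1\<close>] p in auto)
qed

section \<open>Computing a hull with a queue\<close>

lemma runs_load_hull:
  assumes "inp s" and out: "\<And>v. v < n \<Longrightarrow> s ''out'' (int v) = of_bool (v \<in> D)"
  shows "runs load_hull s (Suc n * 100) (\<lambda>s'. \<forall>v<n. s' ''c'' (int v) = \<tau> v \<and>
    s' ''h'' (int v) = of_bool (v \<in> D) \<and> s' ''q'' (int v) = - 1)"
  unfolding load_hull_def
proof (rule runs_For_loopfree[where I = "\<lambda>k s. \<forall>v<k. s ''c'' (int v) = \<tau> v \<and>
    s ''h'' (int v) = of_bool (v \<in> D) \<and> s ''q'' (int v) = - 1" and l = n and a = 0], goal_cases)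
  case (4 k s')
  have i: "inp s'" using assms(1) by (rule inp_frame, intro 4(4)) (auto simp: inputs_def)
  have "s' ''out'' = s ''out''" using 4(4) by simp
  then show ?case using 4(1-3) out inp_simps(9)[OF i 4(1)] by (auto simp: less_Suc_eq)
qed (use inp_simps[OF assms(1)] in auto)

lemma runs_load_bag:
  assumes "inp s" and x: "s x 0 = p" "- 1 \<le> p" "p < int N" and a: "a \<notin> inputs" "a \<noteq> ''j''" "x \<noteq> ''j''" "a \<noteq> x"
    and S: "\<And>v. v < n \<Longrightarrow> s a (int v) = of_bool (v \<in> D)"
  shows "runs (load_bag a x) s (Suc n * 100)
    (\<lambda>s'. \<forall>v<n. s' a (int v) = of_bool (v \<in> D \<union> set (bag_list p)))"
proof -
  have inputs: "''j'' \<notin> inputs" "''start'' \<in> inputs" by (simp_all add: inputs_def)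
  have "runs (load_bag a x) s (Suc (length (bag_list p)) * 100)
    (\<lambda>s'. \<forall>v<n. s' a (int v) = of_bool (v \<in> D \<union> set (bag_list p)))"
    unfolding load_bag_def
  proof (rule runs_For_loopfree[where I = "\<lambda>k s'. \<forall>v<n. s' a (int v) =
      of_bool (v \<in> D \<union> set (take k (bag_list p)))" and l = "length (bag_list p)" and a = "s ''start'' p"], goal_cases)
    case 3
    then show ?case using S a by simp
  next
    case (4 k s')
    have i: "inp s'" using assms(1) by (rule inp_frame, intro 4(4)) (use a(1) inputs in auto)
    have "s' ''start'' = s ''start''" using 4(4)[of "''start''"] a(1) inputs(2) by auto
    then have "s' ''bag'' (s' ''j'' 0) = int (bag_list p ! k)"
      using bag_list_elem[OF i x(3) 4(1)] 4(3) by simp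
    then show ?case using 4(1,2) a
      by (auto simp: take_Suc_conv_app_nth)
  next
    case (6 s')
    have "s' ''start'' = s ''start''" "s' x = s x"
      using 6[of "''start''"] 6[of x] a inputs(2) by auto
    then show ?case using bag_list_start[OF assms(1) x(2,3)] x(1) by simp
  qed (use x a in auto)
  then show ?thesis
    by (rule runs_mono) (use bag_list_length[OF x(3)] in auto)
qed

text \<open>The list \<open>Q\<close> keeps processed vertices too, so \<open>tail\<close> never
  decreases and \<open>h\<close> marks a vertex from the moment it is queued. Because
  \<open>set Q\<close> stays between \<open>S\<close> and \<open>H S\<close>, it only remains to
  show that it is closed in the end.\<close>

definition queue :: "nat list \<Rightarrow> nat set \<Rightarrow> store \<Rightarrow> bool" where
  "queue Q S s \<longleftrightarrow> distinct Q \<and> S \<subseteq> set Q \<and> set Q \<subseteq> H S \<and>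
     (\<forall>v<n. s ''h'' (int v) = of_bool (v \<in> set Q)) \<and> s ''tail'' 0 = int (length Q) \<and>
     (\<forall>i<n. s ''q'' (int i) = (if i < length Q then int (Q ! i) else - 1))"

text \<open>The set \<open>P u\<close> consists of the activated neighbours of \<open>u\<close> that have been
  subtracted from its threshold.\<close>

definition counts :: "nat list \<Rightarrow> (nat \<Rightarrow> nat set) \<Rightarrow> store \<Rightarrow> bool" where
  "counts Q P s \<longleftrightarrow> (\<forall>u<n. P u \<subseteq> set Q \<inter> nbhd G u \<and> s ''c'' (int u) = \<tau> u - int (card (P u)) \<and>
     (u \<notin> set Q \<longrightarrow> 0 < s ''c'' (int u)))"

lemma queue_upd [simp]: "a \<notin> {''h'', ''tail'', ''q''} \<Longrightarrow> queue Q S (s(a := f)) = queue Q S s"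
  by (auto simp: queue_def)

lemma counts_upd [simp]: "a \<noteq> ''c'' \<Longrightarrow> counts Q P (s(a := f)) = counts Q P s"
  by (auto simp: counts_def)

lemma hull_subset_verts: "S \<subseteq> verts G \<Longrightarrow> H S \<subseteq> verts G"
  using hull_is_smallest(1)[OF G] .

lemma in_hull:
  assumes "S \<subseteq> verts G" "u < n" "P \<subseteq> H S \<inter> nbhd G u" "\<tau> u \<le> int (card P)"
  shows "u \<in> H S"
proof -
  have "finite (H S \<inter> nbhd G u)"
    using hull_subset_verts[OF assms(1)] finite_verts(1) finite_subset by blast
  from card_mono[OF this assms(3)] assms(4)
  have "\<tau> u \<le> int (card (H S \<inter> nbhd G u))" by linarith
  then show ?thesis
    using hull_is_smallest(3)[OF G assms(1), of \<tau>] assms(2) in_verts(1) unfolding hull_closed_def by blast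
qed

text \<open>Once all queued vertices have been subtracted, a vertex outside the queue still has a
  positive counter, that is, fewer active neighbours than its threshold. Hence the queue is a closed
  set, and minimality of the hull applies.\<close>

lemma queue_finished:
  assumes "queue Q S s" "counts Q (\<lambda>u. set Q \<inter> nbhd G u) s" "S \<subseteq> verts G"
  shows "set Q = H S"
proof
  show "set Q \<subseteq> H S" using assms(1) by (simp add: queue_def)
  then have "set Q \<subseteq> verts G" using hull_subset_verts[OF assms(3)] by blast
  moreover have "S \<subseteq> set Q" using assms(1) by (simp add: queue_def)
  moreover have "hull_closed G \<tau> (set Q)"
    unfolding hull_closed_def
  proof (intro ballI impI)
    fix u assume "u \<in> verts G" "\<tau> u \<le> int (card (set Q \<inter> nbhd G u))"
    then show "u \<in> set Q" using assms(2) in_verts(1) unfolding counts_def by force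
  qed
  ultimately show "H S \<subseteq> set Q" using hull_is_smallest(4)[OF G] assms(3) by blast
qed

lemma queue_length: "queue Q S s \<Longrightarrow> S \<subseteq> verts G \<Longrightarrow> length Q \<le> n \<and> set Q \<subseteq> verts G"
  using hull_subset_verts[of S] finite_verts(1) card_mono[of "verts G" "set Q"]
  by (auto simp: queue_def distinct_card)

lemma queue_append:
  assumes "queue Q S s" "S \<subseteq> verts G" "w < n" "w \<notin> set Q" "w \<in> H S"
  shows "queue (Q @ [w]) S (s(''h'' := (s ''h'')(int w := 1), ''q'' := (s ''q'')(s ''tail'' 0 := int w),
    ''tail'' := (s ''tail'')(0 := s ''tail'' 0 + 1)))"
  using assms by (auto simp: queue_def nth_append)

text \<open>All vertices subtracted from the threshold of \<open>w\<close> are queued and thus lie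
  in \<open>H S\<close>; a counter that has dropped below 1 therefore certifies
  \<open>w \<in> H S\<close>.\<close>

lemma run_notify:
  assumes Q: "queue Q S s" and P: "counts Q P s" and S: "S \<subseteq> verts G"
    and w: "s ''w'' 0 = int w" "w < n" and x: "x \<in> set Q" "x \<in> nbhd G w" "x \<notin> P w"
  shows "\<exists>Q'. (Q' = Q \<or> Q' = Q @ [w]) \<and> queue Q' S (run notify s) \<and>
    counts Q' (P(w := insert x (P w))) (run notify s)"
proof -
  let ?s = "s(''c'' := (s ''c'')(int w := s ''c'' (int w) - 1))"
  let ?P = "P(w := insert x (P w))"
  have Pw: "P w \<subseteq> set Q \<inter> nbhd G w" using P w(2) by (simp add: counts_def)
  then have "finite (P w)" using finite_subset by blast
  then have c: "s ''c'' (int w) - 1 = \<tau> w - int (card (?P w))"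
    using P w(2) x(3) by (simp add: counts_def)
  show ?thesis
  proof (cases "s ''c'' (int w) - 1 < 1 \<and> w \<notin> set Q")
    case True
    let ?t = "?s(''h'' := (s ''h'')(int w := 1), ''q'' := (s ''q'')(s ''tail'' 0 := int w),
      ''tail'' := (s ''tail'')(0 := s ''tail'' 0 + 1))"
    have "s ''h'' (int w) = 0" using Q w(2) True by (simp add: queue_def)
    then have run: "run notify s = ?t"
      using True w(1) by (simp add: notify_def fun_upd_twist)
    have "w \<in> H S"
      using Pw x True c Q by (intro in_hull[OF S w(2), of "?P w"]) (auto simp: queue_def)
    then have "queue (Q @ [w]) S ?t"
      using queue_append[of Q S ?s w] Q S w(2) True by simp
    moreover have "counts (Q @ [w]) ?P ?t"
      using P c x unfolding counts_def by auto
    ultimately show ?thesis unfolding run by blast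
  next
    case False
    then have run: "run notify s = ?s"
      using w Q by (auto simp: notify_def queue_def)
    have "counts Q ?P ?s"
      using P c x False unfolding counts_def by auto
    moreover have "queue Q S ?s" using Q by simp
    ultimately show ?thesis unfolding run by blast
  qed
qed

lemma runs_init_queue:
  assumes "inp s" and S: "S \<subseteq> verts G"
    and init: "\<forall>v<n. s ''h'' (int v) = of_bool (v \<in> S)" "\<forall>v<n. s ''c'' (int v) = \<tau> v"
      "\<forall>v<n. s ''q'' (int v) = - 1"
  shows "runs init_queue s (10 + Suc n * 100) (\<lambda>s'. \<exists>Q. queue Q S s' \<and> counts Q (\<lambda>_. {}) s')"
  unfolding init_queue_def
proof (rule runs_SeqI)
  show "runs (''tail'' <- Const 0) s 10 (\<lambda>s'. s' ''tail'' 0 = 0)"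
    by (rule runs_mono[OF runs_loopfree]) auto
next
  fix s1 :: store
  assume tail: "s1 ''tail'' 0 = 0" and frame: "\<And>a. a \<notin> writes (''tail'' <- Const 0) \<Longrightarrow> s1 a = s a"
  have i: "inp s1" using assms(1) by (rule inp_frame, intro frame) (auto simp: inputs_def)
  have s1: "s1 ''h'' = s ''h''" "s1 ''c'' = s ''c''" "s1 ''q'' = s ''q''" using frame by simp_all
  \<comment> \<open>During this loop \<open>h\<close> already marks all of \<open>S\<close>, while
    only members below \<open>k\<close> have been queued; the equality of \<open>h\<close> and the
    queue demanded by \<open>queue\<close> is restored at \<open>k = n\<close>.\<close>
  let ?I = "\<lambda>k s. \<exists>Q. distinct Q \<and> set Q = {v. v < k \<and> (v \<in> S \<or> \<tau> v \<le> 0)} \<and>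
      s ''tail'' 0 = int (length Q) \<and> (\<forall>v<n. s ''c'' (int v) = \<tau> v) \<and>
      (\<forall>v<n. s ''h'' (int v) = of_bool (v \<in> S \<or> v \<in> set Q)) \<and>
      (\<forall>i<n. s ''q'' (int i) = (if i < length Q then int (Q ! i) else - 1))"
  show "runs (For ''j'' (Const 0) (V ''n'')
     (If (And (Less (Arr ''h'' (V ''j'')) (Const 1)) (Less (Const 0) (Arr ''c'' (V ''j''))))
        Skip
        (''h''[V ''j''] ::= Const 1 ;;
         ''q''[V ''tail''] ::= V ''j'' ;;
         ''tail'' <- Plus (V ''tail'') (Const 1)))) s1 (Suc n * 100)
     (\<lambda>s'. \<exists>Q. queue Q S s' \<and> counts Q (\<lambda>_. {}) s')"
  proof (rule runs_For_loopfree[where I = "?I" and l = n and a = 0], goal_cases)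
    case 3
    then show ?case using tail init s1 by (auto intro!: exI[of _ "[]"])
  next
    case (4 k s')
    from 4(2) obtain Q where Q: "distinct Q" "set Q = {v. v < k \<and> (v \<in> S \<or> \<tau> v \<le> 0)}"
      "s' ''tail'' 0 = int (length Q)" "\<forall>v<n. s' ''c'' (int v) = \<tau> v"
      "\<forall>v<n. s' ''h'' (int v) = of_bool (v \<in> S \<or> v \<in> set Q)"
      "\<forall>i<n. s' ''q'' (int i) = (if i < length Q then int (Q ! i) else - 1)" by blast
    have "k \<notin> set Q" using Q(2) by simp
    show ?case
    proof (cases "k \<in> S \<or> \<tau> k \<le> 0")
      case True
      then have "set (Q @ [k]) = {v. v < Suc k \<and> (v \<in> S \<or> \<tau> v \<le> 0)}"
        using Q(2) by (auto simp: less_Suc_eq)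
      moreover have "distinct (Q @ [k])" using Q(1) \<open>k \<notin> set Q\<close> by simp
      moreover have "\<not> (s' ''h'' (int k) < 1 \<and> 0 < s' ''c'' (int k))"
        using True Q(4,5) 4(1) by auto
      ultimately show ?thesis
        using Q(3-6) 4(1,3) by (intro exI[of _ "Q @ [k]"]) (auto simp: nth_append)
    next
      case False
      then have "set Q = {v. v < Suc k \<and> (v \<in> S \<or> \<tau> v \<le> 0)}"
        using Q(2) by (auto simp: less_Suc_eq)
      moreover have "s' ''h'' (int k) < 1 \<and> 0 < s' ''c'' (int k)"
        using False Q(4,5) 4(1) \<open>k \<notin> set Q\<close> by auto
      ultimately show ?thesis
        using Q(1,3-6) 4(3) by (intro exI[of _ Q]) auto
    qed
  next
    case (8 s')
    then obtain Q where Q: "distinct Q" "set Q = {v. v < n \<and> (v \<in> S \<or> \<tau> v \<le> 0)}"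
      "s' ''tail'' 0 = int (length Q)" "\<forall>v<n. s' ''c'' (int v) = \<tau> v"
      "\<forall>v<n. s' ''h'' (int v) = of_bool (v \<in> S \<or> v \<in> set Q)"
      "\<forall>i<n. s' ''q'' (int i) = (if i < length Q then int (Q ! i) else - 1)" by blast
    have "S \<subseteq> set Q" using S in_verts(1) Q(2) by blast
    moreover have "set Q \<subseteq> H S"
      using Q(2) in_hull[OF S, of _ "{}"] hull_extensive[of S G \<tau>] by auto
    ultimately have "queue Q S s'" using Q unfolding queue_def by auto
    moreover have "counts Q (\<lambda>_. {}) s'" using Q(2,4) unfolding counts_def by auto
    ultimately show ?case by blast
  qed (use inp_simps[OF i] in auto)
qed

lemma run_other_end:
  assumes "inp s" "s ''j'' 0 = int j" "j < m"
  shows "run other_end s = s(''w'' := (s ''w'')(0 :=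
    if s ''v'' 0 = int (fst (es ! j)) then int (snd (es ! j))
    else if s ''v'' 0 = int (snd (es ! j)) then int (fst (es ! j)) else - 1))"
  using inp_simps(5,6)[OF assms(1,3)] assms(2) by (auto simp: other_end_def)

lemma runs_scan_edges:
  assumes "inp s" and S: "S \<subseteq> verts G" and Q: "queue Q S s"
    and P: "counts Q (\<lambda>u. set (take i Q) \<inter> nbhd G u) s"
    and v: "s ''v'' 0 = (if i < length Q then int (Q ! i) else - 1)"
  shows "runs scan_edges s (Suc m * 100)
    (\<lambda>s'. \<exists>Q'. queue Q' S s' \<and> counts Q' (\<lambda>u. set (take (Suc i) Q') \<inter> nbhd G u) s')"
  unfolding scan_edges_def
proof -
  \<comment> \<open>The second set is the current vertex, counted for those neighbours whose edge is
    among the first \<open>k\<close> scanned. It is empty throughout if the queue cell holds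
    -1.\<close>
  define P where "P k u = set (take i Q) \<inter> nbhd G u \<union>
    {y. s ''v'' 0 = int y \<and> {u, y} \<in> set (take k ES)}" for k u
  \<comment> \<open>The queue grows only while a genuine vertex is processed. Appending then happens
    beyond position \<open>i\<close>, so the processed prefix is stable; with an empty cell the
    queue does not change.\<close>
  let ?I = "\<lambda>k s. \<exists>Q'. (Q' = Q \<or> i < length Q) \<and> take (Suc i) Q' = take (Suc i) Q \<and>
    length Q \<le> length Q' \<and> queue Q' S s \<and> counts Q' (P k) s"
  show "runs (For ''j'' (Const 0) (V ''m'')
     (other_end ;; If (Less (V ''w'') (Const 0)) Skip notify)) s (Suc m * 100)
    (\<lambda>s'. \<exists>Q'. queue Q' S s' \<and> counts Q' (\<lambda>u. set (take (Suc i) Q') \<inter> nbhd G u) s')"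
  proof (rule runs_For_loopfree[where I = "?I" and l = m and a = 0], goal_cases)
    case 3
    have "P 0 = (\<lambda>u. set (take i Q) \<inter> nbhd G u)" by (auto simp: P_def)
    then show ?case using assms(3,4) by auto
  next
    case (4 k s')
    have inp: "inp s'" using assms(1)
      by (rule inp_frame, intro 4(4)) (auto simp: inputs_def other_end_def notify_def)
    have v': "s' ''v'' 0 = s ''v'' 0" using 4(4) by (simp add: other_end_def notify_def)
    from 4(2) obtain Q' where Q': "Q' = Q \<or> i < length Q" "take (Suc i) Q' = take (Suc i) Q"
      "length Q \<le> length Q'" "queue Q' S s'" "counts Q' (P k) s'" by blast
    let ?a = "fst (es ! k)" and ?b = "snd (es ! k)"
    let ?w = "if s ''v'' 0 = int ?a then int ?b else if s ''v'' 0 = int ?b then int ?a else - 1"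
    let ?s = "s'(''w'' := (s' ''w'')(0 := ?w))"
    have ab: "?a < n" "?b < n" "?a \<noteq> ?b" "{?a, ?b} \<in> edges G" "ES ! k = {?a, ?b}"
      using edge_nth[OF 4(1)] by blast+
    have oe: "run other_end s' = ?s" using run_other_end[OF inp _ 4(1)] 4(3) v' by simp
    have take: "set (take (Suc k) ES) = insert {?a, ?b} (set (take k ES))"
      using 4(1) ab(5) by (simp add: take_Suc_conv_app_nth del: nth_map)
    \<comment> \<open>Each edge is listed once, so no neighbour is subtracted twice from the same
      counter.\<close>
    have new: "{?a, ?b} \<notin> set (take k ES)"
    proof -
      have "distinct (take (Suc k) ES)" using edges_eq(3) by (rule distinct_take)
      then show ?thesis using 4(1) ab(5) by (simp add: take_Suc_conv_app_nth del: nth_map)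
    qed
    show ?case
    proof (cases "s ''v'' 0 = int ?a \<or> s ''v'' 0 = int ?b")
      case False
      then have "P (Suc k) = P k" unfolding P_def take by (auto simp: doubleton_eq_iff)
      moreover have "run (other_end ;; If (Less (V ''w'') (Const 0)) Skip notify) s' = ?s"
        using False by (simp add: oe)
      ultimately show ?thesis using Q' by auto
    next
      case True
      then have i: "i < length Q" using v by (auto split: if_splits)
      define x where "x = Q ! i"
      define w where "w = nat ?w"
      have x: "s ''v'' 0 = int x" using v i by (simp add: x_def)
      have wx: "{w, x} = {?a, ?b}" "?w = int w" "w < n" "w \<noteq> x"
        using True ab(1-3) x by (auto simp: w_def)
      define s'' where "s'' = run notify ?s"
      have run: "run (other_end ;; If (Less (V ''w'') (Const 0)) Skip notify) s' = s''"
        using wx(2) by (simp add: oe s''_def)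
      have "take (Suc i) Q' = take i Q @ [x]" using Q'(2) i by (simp add: take_Suc_conv_app_nth x_def)
      then have xQ': "x \<in> set Q'" by (metis in_set_conv_decomp in_set_takeD)
      have "distinct Q" using Q by (simp add: queue_def)
      then have "distinct (take (Suc i) Q)" by (rule distinct_take)
      then have "x \<notin> set (take i Q)" using i by (simp add: take_Suc_conv_app_nth x_def)
      then have xP: "x \<notin> P k w" using new by (simp add: P_def wx(1))
      have xn: "x \<in> nbhd G w" using ab(4) by (simp add: nbhd_def wx(1))
      have PSuc: "P (Suc k) = (P k)(w := insert x (P k w))"
        using x wx(4) unfolding P_def take wx(1)[symmetric] by (auto simp: doubleton_eq_iff fun_eq_iff)
      have "queue Q' S ?s" "counts Q' (P k) ?s" using Q'(4,5) by simp_all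
      from run_notify[OF this S _ wx(3) xQ' xn xP] wx(2) obtain Q'' where
        Q'': "Q'' = Q' \<or> Q'' = Q' @ [w]" "queue Q'' S s''" "counts Q'' (P (Suc k)) s''"
        unfolding PSuc s''_def by auto
      have "take (Suc i) Q'' = take (Suc i) Q" "length Q \<le> length Q''"
        using Q''(1) Q'(2,3) i by auto
      then show ?thesis using Q''(2,3) i unfolding run by auto
    qed
  next
    case (8 s')
    then obtain Q' where Q': "take (Suc i) Q' = take (Suc i) Q" "queue Q' S s'" "counts Q' (P m) s'"
      by blast
    have "P m = (\<lambda>u. set (take (Suc i) Q') \<inter> nbhd G u)"
      using v edges_eq(1) unfolding Q'(1) P_def
      by (auto simp: nbhd_def take_Suc_conv_app_nth fun_eq_iff split: if_splits)
    then show ?case using Q'(2,3) by auto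
  qed (use inp_simps[OF assms(1)] in \<open>auto simp: other_end_def notify_def\<close>)
qed

text \<open>A vertex enters the queue at most once, so \<open>n\<close> rounds process it entirely;
  surplus rounds read -1 and subtract nothing. This is the source of the product of \<open>n\<close>
  and \<open>m\<close> in the cost of one hull.\<close>

lemma runs_run_queue:
  assumes "inp s" and S: "S \<subseteq> verts G" and Q: "queue Q S s" "counts Q (\<lambda>_. {}) s"
  shows "runs run_queue s (Suc n * (Suc m * 100 + 100)) (\<lambda>s'. \<forall>v<n. s' ''h'' (int v) = of_bool (v \<in> H S))"
proof -
  let ?I = "\<lambda>k s. \<exists>Q. queue Q S s \<and> counts Q (\<lambda>u. set (take k Q) \<inter> nbhd G u) s"
  have "runs run_queue s (Suc n * ((10 + Suc m * 100) + acost (Const 0) + acost (V ''n'') + 14))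
    (\<lambda>s'. ?I n s' \<and> (\<forall>b. b \<notin> insert ''i'' (writes (''v'' <- Arr ''q'' (V ''i'') ;; scan_edges)) \<longrightarrow> s' b = s b))"
    unfolding run_queue_def
  proof (rule runs_For[where a = 0 and l = n and I = "?I"])
    show "?I 0 (s(''i'' := (s ''i'')(0 := 0)))" using Q by auto
  next
    fix k s' assume k: "k < n" "?I k s'" "s' ''i'' 0 = 0 + int k"
      and frame: "\<And>b. b \<notin> insert ''i'' (writes (''v'' <- Arr ''q'' (V ''i'') ;; scan_edges)) \<Longrightarrow> s' b = s b"
    have inp: "inp s'" using assms(1)
      by (rule inp_frame, intro frame) (auto simp: inputs_def scan_edges_def other_end_def notify_def)
    from k(2) obtain Q where Q: "queue Q S s'" "counts Q (\<lambda>u. set (take k Q) \<inter> nbhd G u) s'" by blast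
    let ?s = "s'(''v'' := (s' ''v'')(0 := s' ''q'' (int k)))"
    have "inp ?s" using inp by (rule inp_frame) (auto simp: inputs_def)
    moreover have "?s ''v'' 0 = (if k < length Q then int (Q ! k) else - 1)"
      using Q(1) k(1) by (simp add: queue_def)
    ultimately have "runs scan_edges ?s (Suc m * 100)
      (\<lambda>s''. \<exists>Q'. queue Q' S s'' \<and> counts Q' (\<lambda>u. set (take (Suc k) Q') \<inter> nbhd G u) s'')"
      using Q by (intro runs_scan_edges[OF _ S, of _ Q k]) simp_all
    from runs_frame[OF this] have scan: "runs scan_edges ?s (Suc m * 100)
      (\<lambda>s''. s'' ''i'' 0 = 0 + int k \<and> ?I (Suc k) (s''(''i'' := (s'' ''i'')(0 := 0 + int k + 1))))"
      by (rule runs_mono) (auto simp: k(3) scan_edges_def other_end_def notify_def)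
    have v: "runs (''v'' <- Arr ''q'' (V ''i'')) s' 10 (\<lambda>s''. s'' = ?s)"
      using k(3) by (intro runs_mono[OF runs_loopfree]) auto
    show "runs (''v'' <- Arr ''q'' (V ''i'') ;; scan_edges) s' (10 + Suc m * 100)
      (\<lambda>s''. s'' ''i'' 0 = 0 + int k \<and> ?I (Suc k) (s''(''i'' := (s'' ''i'')(0 := 0 + int k + 1))))"
      using scan by (intro runs_SeqI[OF v]) simp
  next
    fix s' assume frame: "\<And>b. b \<notin> insert ''i'' (writes (''v'' <- Arr ''q'' (V ''i'') ;; scan_edges)) \<Longrightarrow> s' b = s b"
    have "inp s'" using assms(1)
      by (rule inp_frame, intro frame) (auto simp: inputs_def scan_edges_def other_end_def notify_def)
    then show "aval (V ''n'') s' = 0 + int n" by (simp add: inp_simps)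
  qed simp
  then show ?thesis
  proof (rule runs_mono)
    fix s' assume "?I n s' \<and> (\<forall>b. b \<notin> insert ''i'' (writes (''v'' <- Arr ''q'' (V ''i'') ;; scan_edges)) \<longrightarrow> s' b = s b)"
    then obtain Q where Q: "queue Q S s'" "counts Q (\<lambda>u. set (take n Q) \<inter> nbhd G u) s'" by blast
    moreover have "take n Q = Q" using queue_length[OF Q(1) S] by simp
    ultimately have "set Q = H S" using queue_finished[OF _ _ S] by simp
    then show "\<forall>v<n. s' ''h'' (int v) = of_bool (v \<in> H S)" using Q(1) by (simp add: queue_def)
  qed (simp add: algebra_simps)
qed

section \<open>One pruning round and the main loop\<close>

definition state :: "nat set \<Rightarrow> nat set \<Rightarrow> store \<Rightarrow> bool" where
  "state A D s \<longleftrightarrow> inp s \<and> (\<forall>x<N. s ''dead'' (int x) = of_bool (x \<notin> A)) \<and>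
     (\<forall>v<n. s ''out'' (int v) = of_bool (v \<in> D))"

lemma state_frame:
  assumes "state A D s" "\<And>a. a \<in> insert ''dead'' (insert ''out'' inputs) \<Longrightarrow> s' a = s a"
  shows "state A D s'"
proof -
  have "inp s" using assms(1) by (simp add: state_def)
  then have "inp s'" by (rule inp_frame) (rule assms(2), simp)
  moreover have "s' ''dead'' = s ''dead''" "s' ''out'' = s ''out''" by (rule assms(2), simp)+
  ultimately show ?thesis using assms(1) by (simp add: state_def)
qed

text \<open>Four passes, two over nodes and two over links, at 100 per iteration; as there are at
  most as many links as nodes, 500 leaves room for the remaining constant.\<close>

lemma runs_search:
  assumes s: "state A D s" and A: "A \<subseteq> {..<N}" "A \<noteq> {}"
  shows "runs search s (500 * Suc N)
    (\<lambda>s'. \<exists>t\<in>A. s' ''t'' 0 = int t \<and> - 1 \<le> s' ''p'' 0 \<and> s' ''p'' 0 < int N \<and>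
       (\<forall>q\<in>A. {t, q} \<in> edges T \<longrightarrow> s' ''p'' 0 = int q) \<and>
       (0 \<le> s' ''p'' 0 \<longrightarrow> nat (s' ''p'' 0) \<in> A - {t}))"
proof -
  let ?Q = "\<lambda>s'. \<exists>t\<in>A. s' ''t'' 0 = int t \<and> card {e \<in> edges T. t \<in> e \<and> e \<subseteq> A} < 2 \<and>
    ((s' ''p'' 0 = - 1 \<and> (\<forall>q\<in>A. {t, q} \<notin> edges T)) \<or>
       (\<exists>q\<in>A. s' ''p'' 0 = int q \<and> {t, q} \<in> edges T))"
  have dead: "s' ''dead'' (int x) = of_bool (x \<notin> A)" if "state A D s'" "x < N" for s' x
    using that by (simp add: state_def)
  have inp: "inp s'" if "state A D s'" for s' using that by (simp add: state_def)
  have "runs (init_degrees ;; count_degrees) s (Suc N * 100 + Suc L * 100)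
    (\<lambda>s'. \<forall>x<N. s' ''deg'' (int x) = int (degree_upto A L x))"
  proof (rule runs_SeqI[OF runs_init_degrees[OF inp[OF s]]])
    fix s' assume *: "\<forall>x<N. s' ''deg'' (int x) = 0" "\<And>a. a \<notin> writes init_degrees \<Longrightarrow> s' a = s a"
    have "state A D s'" using s by (rule state_frame, intro *(2)) (auto simp: inputs_def loop_defs)
    then show "runs count_degrees s' (Suc L * 100)
        (\<lambda>s'. \<forall>x<N. s' ''deg'' (int x) = int (degree_upto A L x))"
      using *(1) inp dead by (intro runs_count_degrees) blast+
  qed
  then have "runs (init_degrees ;; count_degrees ;; pick_leaf) s (Suc N * 100 + Suc L * 100 + Suc N * 100)
    (\<lambda>s'. \<exists>t\<in>A. s' ''t'' 0 = int t \<and> card {e \<in> edges T. t \<in> e \<and> e \<subseteq> A} < 2)"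
  proof (rule runs_SeqI)
    fix s' assume *: "\<forall>x<N. s' ''deg'' (int x) = int (degree_upto A L x)"
      "\<And>a. a \<notin> writes (init_degrees ;; count_degrees) \<Longrightarrow> s' a = s a"
    have "state A D s'" using s by (rule state_frame, intro *(2)) (auto simp: inputs_def loop_defs)
    then show "runs pick_leaf s' (Suc N * 100)
        (\<lambda>s'. \<exists>t\<in>A. s' ''t'' 0 = int t \<and> card {e \<in> edges T. t \<in> e \<and> e \<subseteq> A} < 2)"
      using *(1) inp dead A by (intro runs_pick_leaf) blast+
  qed
  then have "runs search s (Suc N * 100 + Suc L * 100 + Suc N * 100 + (10 + Suc L * 100)) ?Q"
    unfolding search_def
  proof (rule runs_SeqI)
    fix s' assume *: "\<exists>t\<in>A. s' ''t'' 0 = int t \<and> card {e \<in> edges T. t \<in> e \<and> e \<subseteq> A} < 2"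
      "\<And>a. a \<notin> writes (init_degrees ;; count_degrees ;; pick_leaf) \<Longrightarrow> s' a = s a"
    then obtain t where t: "t \<in> A" "s' ''t'' 0 = int t" "card {e \<in> edges T. t \<in> e \<and> e \<subseteq> A} < 2" by blast
    have s': "state A D s'" using s by (rule state_frame, intro *(2)) (auto simp: inputs_def loop_defs)
    have "t < N" using t(1) A(1) by blast
    have "runs find_parent s' (10 + Suc L * 100)
      (\<lambda>s'. (s' ''p'' 0 = - 1 \<and> (\<forall>q\<in>A. {t, q} \<notin> edges T)) \<or>
         (\<exists>q\<in>A. s' ''p'' 0 = int q \<and> {t, q} \<in> edges T))"
      using \<open>t < N\<close> t(2) s' inp dead by (intro runs_find_parent) blast+
    from runs_frame[OF this] show "runs find_parent s' (10 + Suc L * 100) ?Q"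
    proof (rule runs_mono)
      fix s'' assume *: "((s'' ''p'' 0 = - 1 \<and> (\<forall>q\<in>A. {t, q} \<notin> edges T)) \<or>
         (\<exists>q\<in>A. s'' ''p'' 0 = int q \<and> {t, q} \<in> edges T)) \<and>
         (\<forall>a. a \<notin> writes find_parent \<longrightarrow> s'' a = s' a)"
      have "''t'' \<notin> writes find_parent" by (simp add: loop_defs)
      with * t(2) have "s'' ''t'' 0 = int t" by metis
      with * t(1,3) show "?Q s''" by blast
    qed simp
  qed
  then show ?thesis
  proof (rule runs_mono)
    show "Suc N * 100 + Suc L * 100 + Suc N * 100 + (10 + Suc L * 100) \<le> 500 * Suc N"
      using L_le by simp
    fix s' assume "?Q s'"
    then obtain t where t: "t \<in> A" "s' ''t'' 0 = int t" "card {e \<in> edges T. t \<in> e \<and> e \<subseteq> A} < 2"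
      and p: "(s' ''p'' 0 = - 1 \<and> (\<forall>q\<in>A. {t, q} \<notin> edges T)) \<or>
       (\<exists>q\<in>A. s' ''p'' 0 = int q \<and> {t, q} \<in> edges T)" by blast
    have fin: "finite {e \<in> edges T. t \<in> e \<and> e \<subseteq> A}" using simple_graph_finite_edges[OF T] by simp
    \<comment> \<open>Degree below 2 turns the neighbour found by the scan into the only one, which
      is what \<open>pruned_step\<close> requires of a parent.\<close>
    have uniq: "q = q'" if "q \<in> A" "q' \<in> A" "{t, q} \<in> edges T" "{t, q'} \<in> edges T" for q q'
    proof -
      have "card {e \<in> edges T. t \<in> e \<and> e \<subseteq> A} \<le> Suc 0" using t(3) by simp
      then have "{t, q} = {t, q'}" using that t(1) unfolding card_le_Suc0_iff_eq[OF fin] by simp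
      then show ?thesis by (auto simp: doubleton_eq_iff)
    qed
    have irrefl: "{t, t} \<notin> edges T" using T by (auto simp: simple_graph_def)
    show "\<exists>t\<in>A. s' ''t'' 0 = int t \<and> - 1 \<le> s' ''p'' 0 \<and> s' ''p'' 0 < int N \<and>
       (\<forall>q\<in>A. {t, q} \<in> edges T \<longrightarrow> s' ''p'' 0 = int q) \<and>
       (0 \<le> s' ''p'' 0 \<longrightarrow> nat (s' ''p'' 0) \<in> A - {t})"
      using p
    proof
      assume "s' ''p'' 0 = - 1 \<and> (\<forall>q\<in>A. {t, q} \<notin> edges T)"
      then show ?thesis using t(1,2) by (intro bexI[of _ t]) auto
    next
      assume "\<exists>q\<in>A. s' ''p'' 0 = int q \<and> {t, q} \<in> edges T"
      then obtain q where q: "q \<in> A" "s' ''p'' 0 = int q" "{t, q} \<in> edges T" by blast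
      then have "q < N" and "q \<noteq> t" using A(1) irrefl by blast+
      moreover have "\<forall>q'\<in>A. {t, q'} \<in> edges T \<longrightarrow> s' ''p'' 0 = int q'"
        using uniq[OF q(1) _ q(3)] q(2) by blast
      moreover have "nat (s' ''p'' 0) \<in> A - {t}" using q(1,2) \<open>q \<noteq> t\<close> by simp
      ultimately show ?thesis using t(1,2) q(2) by (intro bexI[of _ t] conjI impI) simp_all
    qed
  qed
qed

lemma runs_compute_hull:
  assumes s: "state A D s" and D: "D \<subseteq> verts G" and p: "s ''p'' 0 = p" "- 1 \<le> p" "p < int N"
  shows "runs compute_hull s (600 * (Suc n * Suc m))
    (\<lambda>s'. \<forall>v<n. s' ''h'' (int v) = of_bool (v \<in> H (D \<union> set (bag_list p))))"
proof -
  define S where "S = D \<union> set (bag_list p)"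
  have S: "S \<subseteq> verts G" using D bag_list_verts[OF p(3)] in_verts(1) unfolding S_def by blast
  have inp: "inp s" and out: "\<And>v. v < n \<Longrightarrow> s ''out'' (int v) = of_bool (v \<in> D)"
    using s by (simp_all add: state_def)
  let ?L = "\<lambda>s. (\<forall>v<n. s ''c'' (int v) = \<tau> v) \<and> (\<forall>v<n. s ''q'' (int v) = - 1)"
  have "runs (load_hull ;; load_bag ''h'' ''p'') s (Suc n * 100 + Suc n * 100)
    (\<lambda>s'. ?L s' \<and> (\<forall>v<n. s' ''h'' (int v) = of_bool (v \<in> S)))"
  proof (rule runs_SeqI[OF runs_load_hull[OF inp out]])
    fix s' assume *: "\<forall>v<n. s' ''c'' (int v) = \<tau> v \<and> s' ''h'' (int v) = of_bool (v \<in> D) \<and>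
      s' ''q'' (int v) = - 1" "\<And>a. a \<notin> writes load_hull \<Longrightarrow> s' a = s a"
    have inp': "inp s'" using inp by (rule inp_frame, intro *(2)) (auto simp: inputs_def loop_defs)
    have "s' ''p'' = s ''p''" by (rule *(2)) (simp add: loop_defs)
    then have p': "s' ''p'' 0 = p" using p(1) by simp
    have "runs (load_bag ''h'' ''p'') s' (Suc n * 100)
        (\<lambda>s'. \<forall>v<n. s' ''h'' (int v) = of_bool (v \<in> D \<union> set (bag_list p)))"
      using *(1) by (intro runs_load_bag[OF inp' p' p(2,3)]) (simp_all add: inputs_def)
    from runs_frame[OF this]
    show "runs (load_bag ''h'' ''p'') s' (Suc n * 100)
        (\<lambda>s'. ?L s' \<and> (\<forall>v<n. s' ''h'' (int v) = of_bool (v \<in> S)))"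
      by (rule runs_mono) (use *(1) in \<open>auto simp: loop_defs S_def\<close>)
  qed
  then have "runs (load_hull ;; load_bag ''h'' ''p'' ;; init_queue) s
    (Suc n * 100 + Suc n * 100 + (10 + Suc n * 100)) (\<lambda>s'. \<exists>Q. queue Q S s' \<and> counts Q (\<lambda>_. {}) s')"
  proof (rule runs_SeqI)
    fix s' assume *: "?L s' \<and> (\<forall>v<n. s' ''h'' (int v) = of_bool (v \<in> S))"
      "\<And>a. a \<notin> writes (load_hull ;; load_bag ''h'' ''p'') \<Longrightarrow> s' a = s a"
    have "inp s'" using inp by (rule inp_frame, intro *(2)) (auto simp: inputs_def loop_defs)
    then show "runs init_queue s' (10 + Suc n * 100) (\<lambda>s'. \<exists>Q. queue Q S s' \<and> counts Q (\<lambda>_. {}) s')"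
      using *(1) S by (intro runs_init_queue) auto
  qed
  then have "runs compute_hull s (Suc n * 100 + Suc n * 100 + (10 + Suc n * 100) +
    Suc n * (Suc m * 100 + 100)) (\<lambda>s'. \<forall>v<n. s' ''h'' (int v) = of_bool (v \<in> H S))"
    unfolding compute_hull_def
  proof (rule runs_SeqI)
    fix s' assume *: "\<exists>Q. queue Q S s' \<and> counts Q (\<lambda>_. {}) s'"
      "\<And>a. a \<notin> writes (load_hull ;; load_bag ''h'' ''p'' ;; init_queue) \<Longrightarrow> s' a = s a"
    have "inp s'" using inp by (rule inp_frame, intro *(2)) (auto simp: inputs_def loop_defs)
    then show "runs run_queue s' (Suc n * (Suc m * 100 + 100)) (\<lambda>s'. \<forall>v<n. s' ''h'' (int v) = of_bool (v \<in> H S))"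
      using *(1) runs_run_queue[OF _ S] by blast
  qed
  then show ?thesis unfolding S_def by (rule runs_mono) (simp_all add: algebra_simps)
qed

lemma runs_check_bag:
  assumes "inp s" and t: "s ''t'' 0 = int t" "t < N"
    and h: "\<forall>v<n. s ''h'' (int v) = of_bool (v \<in> Z)"
  shows "runs check_bag s (10 + Suc n * 100) (\<lambda>s'. s' ''f'' 0 = of_bool (\<not> X t \<subseteq> Z))"
  unfolding check_bag_def
proof (rule runs_SeqI)
  show "runs (''f'' <- Const 0) s 10 (\<lambda>s'. s' ''f'' 0 = 0)"
    by (rule runs_mono[OF runs_loopfree]) auto
next
  fix s1 :: store
  assume f: "s1 ''f'' 0 = 0" and frame: "\<And>a. a \<notin> writes (''f'' <- Const 0) \<Longrightarrow> s1 a = s a"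
  have i: "inp s1" using assms(1) by (rule inp_frame, intro frame) (auto simp: inputs_def)
  have s1: "s1 ''h'' = s ''h''" "s1 ''t'' = s ''t''" using frame by simp_all
  let ?B = "bag_list (int t)"
  have B: "set ?B = X t" using set_bag_list[of "int t"] t(2) by simp
  have "runs (For ''j'' (Arr ''start'' (V ''t'')) (Arr ''start'' (Plus (V ''t'') (Const 1)))
      (If (Less (Arr ''h'' (Arr ''bag'' (V ''j''))) (Const 1)) (''f'' <- Const 1) Skip)) s1
      (Suc (length ?B) * 100) (\<lambda>s'. s' ''f'' 0 = of_bool (\<not> X t \<subseteq> Z))"
  proof (rule runs_For_loopfree[where I = "\<lambda>k s. s ''f'' 0 = of_bool (\<not> set (take k ?B) \<subseteq> Z)"
        and l = "length ?B" and a = "s1 ''start'' (int t)"], goal_cases)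
    case (4 k s')
    have i': "inp s'" using i by (rule inp_frame, intro 4(4)) (auto simp: inputs_def)
    have s': "s' ''start'' = s1 ''start''" "s' ''h'' = s ''h''" using 4(4) s1 by simp_all
    have "s' ''bag'' (s' ''j'' 0) = int (?B ! k)"
      using bag_list_elem[OF i' _ 4(1)] 4(3) s'(1) t(2) by simp
    moreover have "?B ! k < n" using bag_list_verts[of "int t"] t(2) 4(1) by simp
    ultimately show ?case using 4(1,2) s'(2) h by (auto simp: take_Suc_conv_app_nth)
  next
    case (6 s')
    have "s' ''start'' = s1 ''start''" "s' ''t'' = s ''t''" using 6 s1 by simp_all
    then show ?case using bag_list_start[OF i, of "int t"] t by simp
  next
    case (8 s')
    then show ?case by (simp add: B)
  qed (use t s1 f in auto)
  then show "runs (For ''j'' (Arr ''start'' (V ''t'')) (Arr ''start'' (Plus (V ''t'') (Const 1)))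
      (If (Less (Arr ''h'' (Arr ''bag'' (V ''j''))) (Const 1)) (''f'' <- Const 1) Skip)) s1
      (Suc n * 100) (\<lambda>s'. s' ''f'' 0 = of_bool (\<not> X t \<subseteq> Z))"
    by (rule runs_mono) (use bag_list_length[of "int t"] t(2) in auto)
qed

lemma runs_prune_leaf:
  assumes s: "state A D s" and A: "A \<subseteq> {..<N}" "A \<noteq> {}" and pruned: "pruned A D"
  shows "runs prune_leaf s (1500 * (Suc N + Suc n * Suc m))
    (\<lambda>s'. \<exists>t\<in>A. \<exists>D'. state (A - {t}) D' s' \<and> pruned (A - {t}) D')"
    (is "runs _ _ _ ?Q")
proof -
  have D: "D \<subseteq> verts G" using pruned unfolding pruned_def attached_def by blast
  have "runs prune_leaf s (500 * Suc N + (600 * (Suc n * Suc m) + ((10 + Suc n * 100) +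
    ((1 + bcost (Less (Const 0) (V ''f'')) + Suc n * 100) + 10)))) ?Q"
    unfolding prune_leaf_def
  proof (rule runs_SeqI[OF runs_search[OF s A]])
    fix s1 :: store
    assume "\<exists>t\<in>A. s1 ''t'' 0 = int t \<and> - 1 \<le> s1 ''p'' 0 \<and> s1 ''p'' 0 < int N \<and>
       (\<forall>q\<in>A. {t, q} \<in> edges T \<longrightarrow> s1 ''p'' 0 = int q) \<and>
       (0 \<le> s1 ''p'' 0 \<longrightarrow> nat (s1 ''p'' 0) \<in> A - {t})"
    then obtain t where t: "t \<in> A" "s1 ''t'' 0 = int t" and p: "- 1 \<le> s1 ''p'' 0" "s1 ''p'' 0 < int N"
       "\<And>q. q \<in> A \<Longrightarrow> {t, q} \<in> edges T \<Longrightarrow> s1 ''p'' 0 = int q"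
       "0 \<le> s1 ''p'' 0 \<Longrightarrow> nat (s1 ''p'' 0) \<in> A - {t}" by blast
    assume frame1: "\<And>a. a \<notin> writes search \<Longrightarrow> s1 a = s a"
    have s1: "state A D s1" using s by (rule state_frame, intro frame1) (auto simp: inputs_def loop_defs)
    define p' where "p' = (if s1 ''p'' 0 < 0 then None else Some (nat (s1 ''p'' 0)))"
    define Z where "Z = H (D \<union> case_option {} X p')"
    have "t < N" using t(1) A(1) by blast
    have hull: "runs compute_hull s1 (600 * (Suc n * Suc m)) (\<lambda>s'. \<forall>v<n. s' ''h'' (int v) = of_bool (v \<in> Z))"
      using runs_compute_hull[OF s1 D refl p(1,2)] unfolding Z_def p'_def set_bag_list[OF p(2)] .
    show "runs (compute_hull ;; (check_bag ;; (If (Less (Const 0) (V ''f'')) (load_bag ''out'' ''t'') Skip ;;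
        ''dead''[V ''t''] ::= Const 1))) s1 (600 * (Suc n * Suc m) + ((10 + Suc n * 100) +
        ((1 + bcost (Less (Const 0) (V ''f'')) + Suc n * 100) + 10))) ?Q"
    proof (rule runs_SeqI[OF hull])
      fix s2 :: store assume h: "\<forall>v<n. s2 ''h'' (int v) = of_bool (v \<in> Z)"
        and frame2: "\<And>a. a \<notin> writes compute_hull \<Longrightarrow> s2 a = s1 a"
      have s2: "state A D s2" using s1 by (rule state_frame, intro frame2) (auto simp: inputs_def loop_defs)
      have "s2 ''t'' = s1 ''t''" by (rule frame2) (simp add: loop_defs)
      then have t2: "s2 ''t'' 0 = int t" using t(2) by simp
      have check: "runs check_bag s2 (10 + Suc n * 100) (\<lambda>s'. s' ''f'' 0 = of_bool (\<not> X t \<subseteq> Z))"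
        using s2 h \<open>t < N\<close> t2 by (intro runs_check_bag) (simp_all add: state_def)
      show "runs (check_bag ;; (If (Less (Const 0) (V ''f'')) (load_bag ''out'' ''t'') Skip ;;
        ''dead''[V ''t''] ::= Const 1)) s2 ((10 + Suc n * 100) +
        ((1 + bcost (Less (Const 0) (V ''f'')) + Suc n * 100) + 10)) ?Q"
      proof (rule runs_SeqI[OF check])
        fix s3 :: store assume f: "s3 ''f'' 0 = of_bool (\<not> X t \<subseteq> Z)"
          and frame3: "\<And>a. a \<notin> writes check_bag \<Longrightarrow> s3 a = s2 a"
        have s3: "state A D s3" using s2 by (rule state_frame, intro frame3) (auto simp: inputs_def loop_defs)
        have "s3 ''t'' = s2 ''t''" by (rule frame3) (simp add: loop_defs)
        then have t3: "s3 ''t'' 0 = int t" using t2 by simp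
        define D' where "D' = (if X t \<subseteq> Z then D else D \<union> X t)"
        have B: "set (bag_list (int t)) = X t" using set_bag_list[of "int t"] \<open>t < N\<close> by simp
        have inp3: "inp s3" and out3: "\<And>v. v < n \<Longrightarrow> s3 ''out'' (int v) = of_bool (v \<in> D)"
          using s3 by (simp_all add: state_def)
        have add: "runs (If (Less (Const 0) (V ''f'')) (load_bag ''out'' ''t'') Skip) s3
          (1 + bcost (Less (Const 0) (V ''f'')) + Suc n * 100) (\<lambda>s'. \<forall>v<n. s' ''out'' (int v) = of_bool (v \<in> D'))"
        proof (rule runs_If)
          assume "bval (Less (Const 0) (V ''f'')) s3"
          then have "D' = D \<union> set (bag_list (int t))" using f B by (auto simp: D'_def)
          then show "runs (load_bag ''out'' ''t'') s3 (Suc n * 100) (\<lambda>s'. \<forall>v<n. s' ''out'' (int v) = of_bool (v \<in> D'))"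
            using runs_load_bag[OF inp3 t3 _ _ _ _ _ _ out3] \<open>t < N\<close> by (simp add: inputs_def)
        next
          assume "\<not> bval (Less (Const 0) (V ''f'')) s3"
          then have "D' = D" using f by (auto simp: D'_def)
          then show "runs Skip s3 (Suc n * 100) (\<lambda>s'. \<forall>v<n. s' ''out'' (int v) = of_bool (v \<in> D'))"
            using out3 by (intro runs_mono[OF runs_loopfree]) auto
        qed
        show "runs (If (Less (Const 0) (V ''f'')) (load_bag ''out'' ''t'') Skip ;; ''dead''[V ''t''] ::= Const 1) s3
          ((1 + bcost (Less (Const 0) (V ''f'')) + Suc n * 100) + 10) ?Q"
        proof (rule runs_SeqI[OF add])
          fix s4 :: store assume out4: "\<forall>v<n. s4 ''out'' (int v) = of_bool (v \<in> D')"
            and frame4: "\<And>a. a \<notin> writes (If (Less (Const 0) (V ''f'')) (load_bag ''out'' ''t'') Skip) \<Longrightarrow> s4 a = s3 a"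
          have inp4: "inp s4" using inp3 by (rule inp_frame, intro frame4) (auto simp: inputs_def loop_defs)
          have same: "s4 ''t'' = s3 ''t''" "s4 ''dead'' = s3 ''dead''" by (rule frame4; simp add: loop_defs)+
          let ?s = "s4(''dead'' := (s4 ''dead'')(int t := 1))"
          have "inp ?s" using inp4 by (rule inp_frame) (auto simp: inputs_def)
          moreover have "\<forall>x<N. ?s ''dead'' (int x) = of_bool (x \<notin> A - {t})"
            using s3 same(2) by (auto simp: state_def)
          ultimately have "state (A - {t}) D' ?s" using out4 by (simp add: state_def)
          moreover have "pruned (A - {t}) D'"
            unfolding D'_def Z_def
          proof (rule pruned_step[OF pruned t(1)])
            show "p' = Some q" if "q \<in> A" "{t, q} \<in> edges T" for q
              using p(3)[OF that] by (simp add: p'_def)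
            show "q \<in> A - {t}" if "p' = Some q" for q
              using that p(4) by (simp add: p'_def split: if_splits)
          qed
          ultimately have "?Q ?s" using t(1) by blast
          moreover have "run (''dead''[V ''t''] ::= Const 1) s4 = ?s" using same(1) t3 by simp
          ultimately show "runs (''dead''[V ''t''] ::= Const 1) s4 10 ?Q"
            by (intro runs_mono[OF runs_loopfree[where Q = ?Q]]) simp_all
        qed
      qed
    qed
  qed
  then show ?thesis by (rule runs_mono) (simp_all add: algebra_simps)
qed

lemma runs_approximate_dyn:
  "runs approximate_dyn (input_store G es \<tau> T fs Xs) (Suc N * (1500 * (Suc N + Suc n * Suc m) + 17))
    (\<lambda>s. dynamic_monopoly G \<tau> (output_set G s) \<and>
      int (card (output_set G s)) \<le> (width T X + 1) * int (dyn G \<tau>))"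
proof -
  let ?s = "input_store G es \<tau> T fs Xs"
  \<comment> \<open>The loop counter determines only how many nodes remain; which ones depends on
    the leaves picked.\<close>
  let ?I = "\<lambda>k s. \<exists>A D. A \<subseteq> {..<N} \<and> card A = N - k \<and> state A D s \<and> pruned A D"
  have frame_k: "state A D (s(''k'' := f)) = state A D s" for A D s f
    unfolding state_def inp_def by (auto simp: inputs_def)
  have inp: "inp s" if "\<And>b. b \<notin> insert ''k'' (writes prune_leaf) \<Longrightarrow> s b = ?s b" for s
    unfolding inp_def by (intro ballI that) (auto simp: inputs_def loop_defs)
  have "runs approximate_dyn ?s
    (Suc N * (1500 * (Suc N + Suc n * Suc m) + acost (Const 0) + acost (V ''nodes'') + 14))
    (\<lambda>s'. ?I N s' \<and> (\<forall>b. b \<notin> insert ''k'' (writes prune_leaf) \<longrightarrow> s' b = ?s b))"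
    unfolding approximate_dyn_def
  proof (rule runs_For[where a = 0 and l = N and I = "?I"])
    have "state (verts T) {} ?s"
      by (auto simp: state_def inp_def input_store_def in_verts)
    moreover have "verts T \<subseteq> {..<N}" using verts_eq(2) by (rule equalityD1)
    ultimately show "?I 0 (?s(''k'' := (?s ''k'')(0 := 0)))"
      using pruned_init unfolding frame_k by (intro exI[of _ "verts T"] exI[of _ "{}"]) simp
  next
    fix k s' assume k: "k < N" "?I k s'" "s' ''k'' 0 = 0 + int k"
    then obtain A D where A: "A \<subseteq> {..<N}" "card A = N - k" "state A D s'" "pruned A D" by blast
    then have "A \<noteq> {}" and "finite A" using k(1) finite_subset by auto
    from runs_frame[OF runs_prune_leaf[OF A(3,1) this(1) A(4)]]
    show "runs prune_leaf s' (1500 * (Suc N + Suc n * Suc m)) (\<lambda>s''. s'' ''k'' 0 = 0 + int k \<and>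
        ?I (Suc k) (s''(''k'' := (s'' ''k'')(0 := 0 + int k + 1))))"
    proof (rule runs_mono)
      fix s'' assume *: "(\<exists>t\<in>A. \<exists>D'. state (A - {t}) D' s'' \<and> pruned (A - {t}) D') \<and>
        (\<forall>a. a \<notin> writes prune_leaf \<longrightarrow> s'' a = s' a)"
      then obtain t D' where t: "t \<in> A" "state (A - {t}) D' s''" "pruned (A - {t}) D'" by blast
      have "s'' ''k'' = s' ''k''" using * by (simp add: loop_defs)
      moreover have "card (A - {t}) = N - Suc k" using t(1) A(2) \<open>finite A\<close> by simp
      moreover have "A - {t} \<subseteq> {..<N}" using A(1) by blast
      ultimately show "s'' ''k'' 0 = 0 + int k \<and>
        ?I (Suc k) (s''(''k'' := (s'' ''k'')(0 := 0 + int k + 1)))"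
        using t(2,3) k(3) unfolding frame_k by metis
    qed simp
  next
    fix s' assume "\<And>b. b \<notin> insert ''k'' (writes prune_leaf) \<Longrightarrow> s' b = ?s b"
    then have "inp s'" by (rule inp)
    then show "aval (V ''nodes'') s' = 0 + int N" by (simp add: inp_simps)
  qed simp
  then show ?thesis
  proof (rule runs_mono)
    fix s assume "?I N s \<and> (\<forall>b. b \<notin> insert ''k'' (writes prune_leaf) \<longrightarrow> s b = ?s b)"
    then obtain A D where A: "A \<subseteq> {..<N}" "card A = 0" "state A D s" "pruned A D" by auto
    have "finite A" using A(1) by (rule finite_subset) simp
    then have "A = {}" using A(2) by simp
    then have "pruned {} D" using A(4) by simp
    note D = pruned_final[OF this]
    have "D \<subseteq> verts G" using D(1) by (simp add: dynamic_monopoly_def)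
    then have "output_set G s = D"
      using A(3) in_verts(1) unfolding output_set_def state_def by auto
    then show "dynamic_monopoly G \<tau> (output_set G s) \<and>
      int (card (output_set G s)) \<le> (width T X + 1) * int (dyn G \<tau>)" using D by simp
  qed simp
qed

end

text \<open>One program serves all \<open>K\<close>; only the constant in the time bound depends on
  \<open>K\<close>. The factor \<open>max 1 m\<close> equals \<open>m\<close> for graphs with an
  edge; for edgeless graphs the literal bound would be 0, while every execution takes at least one
  unit.\<close>

theorem theorem8:
  shows "\<exists>P :: com. \<forall>K :: nat. \<exists>C :: nat.
    \<forall>(G :: nat graph) (\<tau> :: nat \<Rightarrow> int) (T :: nat graph) (X :: nat \<Rightarrow> nat set) es fs Xs n m.
      simple_graph G \<and> n = card (verts G) \<and> m = card (edges G) \<and>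
      tree_decomposition G T X \<and> card (verts T) \<le> K * n \<and>
      graph_code G es \<and> graph_code T fs \<and> bags_code T X Xs \<longrightarrow>
      (\<exists>t s. exec P (input_store G es \<tau> T fs Xs) t s \<and>
             dynamic_monopoly G \<tau> (output_set G s) \<and>
             int (card (output_set G s)) \<le> (width T X + 1) * int (dyn G \<tau>) \<and>
             t \<le> C * (n\<^sup>2 * max 1 m))"
proof (rule exI[of _ approximate_dyn], intro allI)
  fix K :: nat
  \<comment> \<open>As the tree is nonempty, the number of nodes plus one is at most
    \<open>2 * K * n\<close>, which bounds the rounds and forces \<open>n \<ge> 1\<close>. The 4
    comes from \<open>Suc n * Suc m \<le> (2 * n) * (2 * max 1 m)\<close>, and 17 is the overhead of
    the outer loop per round.\<close>
  let ?C = "2 * K * (1500 * (2 * K + 4) + 17)"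
  show "\<exists>C. \<forall>(G :: nat graph) (\<tau> :: nat \<Rightarrow> int) (T :: nat graph) (X :: nat \<Rightarrow> nat set) es fs Xs n m.
      simple_graph G \<and> n = card (verts G) \<and> m = card (edges G) \<and>
      tree_decomposition G T X \<and> card (verts T) \<le> K * n \<and>
      graph_code G es \<and> graph_code T fs \<and> bags_code T X Xs \<longrightarrow>
      (\<exists>t s. exec approximate_dyn (input_store G es \<tau> T fs Xs) t s \<and>
             dynamic_monopoly G \<tau> (output_set G s) \<and>
             int (card (output_set G s)) \<le> (width T X + 1) * int (dyn G \<tau>) \<and>
             t \<le> C * (n\<^sup>2 * max 1 m))"
  proof (rule exI[of _ ?C], intro allI impI, elim conjE)
    fix G T :: "nat graph" and \<tau> :: "nat \<Rightarrow> int" and X :: "nat \<Rightarrow> nat set" and es fs Xs n m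
    assume G: "simple_graph G" and n: "n = card (verts G)" and m: "m = card (edges G)"
      and TD: "tree_decomposition G T X" and K: "card (verts T) \<le> K * n"
      and codes: "graph_code G es" "graph_code T fs" "bags_code T X Xs"
    interpret coded_decomposition G \<tau> T X es fs Xs
      using G TD codes by unfold_locales
    have len: "length es = m" using m_eq m by simp
    have "verts T \<noteq> {}" using TD by (auto simp: tree_decomposition_def tree_def connected_graph_def)
    then have N: "1 \<le> card (verts T)" using finite_verts(2) by (simp add: Suc_le_eq card_gt_0_iff)
    then have "1 \<le> n" using K by (cases n) auto
    define M where "M = max 1 m"
    have "1 \<le> M" and "m \<le> M" by (simp_all add: M_def)
    have T_le: "Suc (card (verts T)) \<le> 2 * K * n" using N K by simp
    also have "\<dots> \<le> 2 * K * (n * M)" using \<open>1 \<le> M\<close> by simp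
    finally have "Suc (card (verts T)) \<le> 2 * K * (n * M)" .
    moreover have "Suc n * Suc m \<le> (2 * n) * (2 * M)"
      using \<open>1 \<le> n\<close> \<open>1 \<le> M\<close> \<open>m \<le> M\<close> by (intro mult_le_mono) simp_all
    then have "Suc n * Suc m \<le> 4 * (n * M)" by (simp only: mult_ac)
    moreover have "1 \<le> n * M" using \<open>1 \<le> n\<close> \<open>1 \<le> M\<close> by simp
    ultimately have "1500 * (Suc (card (verts T)) + Suc n * Suc m) + 17 \<le>
        1500 * (2 * K * (n * M) + 4 * (n * M)) + 17 * (n * M)"
      by (intro add_mono mult_le_mono2) simp_all
    also have "\<dots> = (1500 * (2 * K + 4) + 17) * (n * M)" by (simp add: algebra_simps)
    finally have "1500 * (Suc (card (verts T)) + Suc n * Suc m) + 17 \<le> (1500 * (2 * K + 4) + 17) * (n * M)" .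
    with T_le
    have "Suc (card (verts T)) * (1500 * (Suc (card (verts T)) + Suc n * Suc m) + 17)
        \<le> (2 * K * n) * ((1500 * (2 * K + 4) + 17) * (n * M))"
      by (rule mult_le_mono)
    also have "\<dots> = ?C * (n\<^sup>2 * max 1 m)" by (simp add: M_def power2_eq_square)
    finally have "Suc (card (verts T)) * (1500 * (Suc (card (verts T)) + Suc (card (verts G)) * Suc (length es)) + 17)
        \<le> ?C * (n\<^sup>2 * max 1 m)"
      by (simp only: n len)
    then show "\<exists>t s. exec approximate_dyn (input_store G es \<tau> T fs Xs) t s \<and>
             dynamic_monopoly G \<tau> (output_set G s) \<and>
             int (card (output_set G s)) \<le> (width T X + 1) * int (dyn G \<tau>) \<and>
             t \<le> ?C * (n\<^sup>2 * max 1 m)"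
      using runs_approximate_dyn unfolding runs_def by (meson order_trans)
  qed
qed

end
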